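(* Let $T$ be a closed densely defined operator in a complex Hilbert space $\mathcal H$ and let $n$ be an integer greater than $1$. Suppose that $T$ is subnormal and $T^n$ is quasinormal. Then $T$ is quasinormal.
   Context: Operators are linear, possibly unbounded; $T^n$ has its natural domain $\mathcal D(T^n)=\{h: h\in\mathcal D(T),\,Th\in\mathcal D(T^{n-1})\}$. A closed densely defined operator $T$ in $\mathcal H$ is quasinormal if $T(T^*T)=(T^*T)T$ (equality of operators including domains); equivalently, $E(\Delta)T\subseteq TE(\Delta)$ for every Borel set $\Delta\subseteq[0,\infty)$, where $E$ is the spectral measure of $|T|=(T^*T)^{1/2}$. A densely defined operator $T$ in $\mathcal H$ is subnormal if there exist a complex Hilbert space $\mathcal K\supseteq\mathcal H$ (isometric embedding) and a normal operator $N$ in $\mathcal K$ with $\mathcal D(T)\subseteq\mathcal D(N)$ and $Th=Nh$ for all $h\in\mathcal D(T)$. *)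

theory Defs
  imports "HOL-Analysis.Analysis"
begin

class complex_hilbert = real_normed_vector + complete_space +
  fixes scaleC :: "complex \<Rightarrow> 'a \<Rightarrow> 'a" (infixr "*\<^sub>C" 75)
    and cinner :: "'a \<Rightarrow> 'a \<Rightarrow> complex"
  assumes scaleC_add_right: "a *\<^sub>C (x + y) = a *\<^sub>C x + a *\<^sub>C y"
    and scaleC_add_left: "(a + b) *\<^sub>C x = a *\<^sub>C x + b *\<^sub>C x"
    and scaleC_scaleC: "a *\<^sub>C (b *\<^sub>C x) = (a * b) *\<^sub>C x"
    and scaleC_one: "1 *\<^sub>C x = x"
    and scaleR_scaleC: "scaleR r x = complex_of_real r *\<^sub>C x"
    and cinner_add_left: "cinner (x + y) z = cinner x z + cinner y z"
    and cinner_scaleC_left: "cinner (a *\<^sub>C x) y = a * cinner x y"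
    and cinner_commute: "cinner x y = cnj (cinner y x)"
    and cinner_pos: "Im (cinner x x) = 0 \<and> Re (cinner x x) \<ge> 0"
    and cinner_eq_zero: "cinner x x = 0 \<longleftrightarrow> x = 0"
    and norm_cinner: "norm x = sqrt (Re (cinner x x))"

text \<open>An operator from H to K is a partial map; its domain is dom T.
Composition of operators is map composition, which carries exactly the natural
domain D(ST) = {h \<in> D(T). Th \<in> D(S)}. Equality of operators is equality of maps
(including domains).\<close>

definition linear_op :: "('a::complex_hilbert \<rightharpoonup> 'b::complex_hilbert) \<Rightarrow> bool" where
  "linear_op T \<longleftrightarrow> 0 \<in> dom T \<and>
     (\<forall>x\<in>dom T. \<forall>y\<in>dom T. x + y \<in> dom T \<and> the (T (x + y)) = the (T x) + the (T y)) \<and>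
     (\<forall>c x. x \<in> dom T \<longrightarrow> c *\<^sub>C x \<in> dom T \<and> the (T (c *\<^sub>C x)) = c *\<^sub>C the (T x))"

definition densely_defined :: "('a::complex_hilbert \<rightharpoonup> 'b::complex_hilbert) \<Rightarrow> bool" where
  "densely_defined T \<longleftrightarrow> closure (dom T) = UNIV"

definition graph_op :: "('a \<rightharpoonup> 'b) \<Rightarrow> ('a \<times> 'b) set" where
  "graph_op T = {(x, the (T x)) | x. x \<in> dom T}"

definition closed_op :: "('a::complex_hilbert \<rightharpoonup> 'b::complex_hilbert) \<Rightarrow> bool" where
  "closed_op T \<longleftrightarrow> closed (graph_op T)"

definition adjoint_op :: "('a::complex_hilbert \<rightharpoonup> 'b::complex_hilbert) \<Rightarrow> ('b \<rightharpoonup> 'a)" where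
  "adjoint_op T = (\<lambda>y. if \<exists>z. \<forall>x\<in>dom T. cinner (the (T x)) y = cinner x z
                      then Some (SOME z. \<forall>x\<in>dom T. cinner (the (T x)) y = cinner x z)
                      else None)"

primrec op_pow :: "('a \<rightharpoonup> 'a) \<Rightarrow> nat \<Rightarrow> ('a \<rightharpoonup> 'a)" where
  "op_pow T 0 = Some"
| "op_pow T (Suc n) = op_pow T n \<circ>\<^sub>m T"

definition quasinormal :: "('a::complex_hilbert \<rightharpoonup> 'a) \<Rightarrow> bool" where
  "quasinormal T \<longleftrightarrow> linear_op T \<and> closed_op T \<and> densely_defined T \<and>
     T \<circ>\<^sub>m (adjoint_op T \<circ>\<^sub>m T) = (adjoint_op T \<circ>\<^sub>m T) \<circ>\<^sub>m T"

definition normal_op :: "('a::complex_hilbert \<rightharpoonup> 'a) \<Rightarrow> bool" where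
  "normal_op N \<longleftrightarrow> linear_op N \<and> closed_op N \<and> densely_defined N \<and>
     adjoint_op N \<circ>\<^sub>m N = N \<circ>\<^sub>m adjoint_op N"

definition isometric_embedding :: "('a::complex_hilbert \<Rightarrow> 'b::complex_hilbert) \<Rightarrow> bool" where
  "isometric_embedding V \<longleftrightarrow> (\<forall>x y. V (x + y) = V x + V y) \<and>
     (\<forall>c x. V (c *\<^sub>C x) = c *\<^sub>C V x) \<and> (\<forall>x. norm (V x) = norm x)"

text \<open>T is subnormal via the space 'b: there is an isometric embedding V of H into K
and a normal N in K with V(D(T)) \<subseteq> D(N) and N(Vh) = V(Th).  Since HOL cannot
quantify existentially over types, the theorem takes 'b as a free (hence
universally quantified) type variable in the hypothesis, which is equivalent.\<close>

definition subnormal_via :: "('a::complex_hilbert \<Rightarrow> 'b::complex_hilbert) \<Rightarrow> ('b \<rightharpoonup> 'b) \<Rightarrow> ('a \<rightharpoonup> 'a) \<Rightarrow> bool" where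
  "subnormal_via V N T \<longleftrightarrow> densely_defined T \<and> isometric_embedding V \<and> normal_op N \<and>
     (\<forall>h\<in>dom T. V h \<in> dom N \<and> the (N (V h)) = V (the (T h)))"

definition subnormal :: "'b::complex_hilbert itself \<Rightarrow> ('a::complex_hilbert \<rightharpoonup> 'a) \<Rightarrow> bool" where
  "subnormal _ T \<longleftrightarrow> (\<exists>(V::'a \<Rightarrow> 'b) N. subnormal_via V N T)"

end

theory Submission
  imports Defs
begin

text \<open>
  Let \<open>N\<close> be a normal extension of \<open>T\<close>, \<open>A = T\<^sup>n\<close> and \<open>B = A\<^sup>*A\<close>. Quasinormality of \<open>A\<close> gives
  \<open>\<parallel>A\<^sup>2h\<parallel> = \<parallel>Bh\<parallel>\<close>, and normality of \<open>N\<close> gives \<open>\<parallel>N\<^sup>2\<^sup>nh\<parallel> = \<parallel>(N\<^sup>*N)\<^sup>nh\<parallel>\<close>. As \<open>B\<close> is the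
  compression of \<open>(N\<^sup>*N)\<^sup>n\<close> to \<open>H\<close> and the norms agree, \<open>B \<subseteq> (N\<^sup>*N)\<^sup>n\<close>; hence \<open>H\<close> is invariant
  under \<open>(1 + (N\<^sup>*N)\<^sup>n)\<^sup>-\<^sup>1\<close>, and so under \<open>J = (1 + N\<^sup>*N)\<^sup>-\<^sup>1\<close>, which is a norm limit of
  polynomials in that operator. Moreover \<open>J\<^sup>n\<close> maps \<open>H\<close> into the domain of \<open>A\<close>, which makes the
  domain of \<open>T\<close> all of the trace of the domain of \<open>N\<close> on \<open>H\<close>. Therefore \<open>T\<^sup>*T\<close> is the restriction
  of \<open>N\<^sup>*N\<close> to \<open>H\<close> and inherits its commutation with \<open>N\<close>.

  No spectral theorem is needed: the only functional calculus is that of real polynomials of a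
  positive contraction, where positivity is read off from Bernstein coefficients.
\<close>

subsection \<open>The real inner product and orthogonal projections\<close>

text \<open>Domains of linear operators are invariant under multiplication by \<open>\<i>\<close>, so the real part of
  the inner product determines adjoints.\<close>

definition rin :: "'a::complex_hilbert \<Rightarrow> 'a \<Rightarrow> real" where
  "rin x y = Re (cinner x y)"

lemma cinner_self: "cinner x x = complex_of_real ((norm x)\<^sup>2)"
  using cinner_pos[of x] norm_cinner[of x] by (simp add: complex_eq_iff)

lemma rin_self: "rin x x = (norm x)\<^sup>2"
  by (simp add: rin_def cinner_self)

lemma rin_commute: "rin x y = rin y x"
  unfolding rin_def by (subst cinner_commute) simp

lemma rin_add_left: "rin (x + y) z = rin x z + rin y z"
  by (simp add: rin_def cinner_add_left)

lemma rin_scaleR_left: "rin (r *\<^sub>R x) y = r * rin x y"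
  by (simp add: rin_def scaleR_scaleC cinner_scaleC_left)

lemma rin_add_right: "rin z (x + y) = rin z x + rin z y"
  using rin_add_left[of x y z] by (simp add: rin_commute)

lemma rin_scaleR_right: "rin y (r *\<^sub>R x) = r * rin y x"
  using rin_scaleR_left[of r x y] by (simp add: rin_commute)

lemma norm_add_square: "(norm (x + y))\<^sup>2 = (norm x)\<^sup>2 + 2 * rin x y + (norm y)\<^sup>2"
  using rin_commute[of x y] by (simp add: rin_self[symmetric] rin_add_left rin_add_right)

lemma rin_le: "rin x y \<le> norm x * norm y"
proof -
  have "(norm (x + y))\<^sup>2 \<le> (norm x + norm y)\<^sup>2"
    by (simp add: norm_triangle_ineq power_mono)
  then show ?thesis
    by (simp add: norm_add_square power2_sum)
qed

lemma abs_rin_le: "\<bar>rin x y\<bar> \<le> norm x * norm y"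
  using rin_le[of x y] rin_le[of "-1 *\<^sub>R x" y] rin_scaleR_left[of "-1" x y] by simp

lemma bounded_bilinear_rin: "bounded_bilinear rin"
  by unfold_locales
     (auto simp: rin_add_left rin_add_right rin_scaleR_left rin_scaleR_right
       intro!: exI[of _ 1] abs_rin_le)

interpretation rin: bounded_bilinear rin
  by (rule bounded_bilinear_rin)

lemma norm_diff_square: "(norm (x - y))\<^sup>2 = (norm x)\<^sup>2 - 2 * rin x y + (norm y)\<^sup>2"
  using norm_add_square[of x "- y"] by (simp add: rin.minus_right)

lemma Im_cinner_eq_rin: "Im (cinner x y) = - rin (\<i> *\<^sub>C x) y"
  by (simp add: rin_def cinner_scaleC_left)

text \<open>The form \<open>ip\<close> is abstract so that one proof serves both a Hilbert space and
  a product of two, where graphs live. A minimising sequence of distances is Cauchy by the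
  parallelogram law, and minimality along lines through its limit forces orthogonality.\<close>

lemma orthogonal_projection_exists:
  fixes ip :: "'a::{real_normed_vector,complete_space} \<Rightarrow> 'a \<Rightarrow> real"
  assumes add: "\<And>x y z. ip (x + y) z = ip x z + ip y z"
    and scale: "\<And>r x y. ip (r *\<^sub>R x) y = r * ip x y"
    and commute: "\<And>x y. ip x y = ip y x"
    and self: "\<And>x. ip x x = (norm x)\<^sup>2"
    and S: "subspace S" "closed S"
  shows "\<exists>q\<in>S. \<forall>s\<in>S. ip (p - q) s = 0"
proof -
  have add': "ip z (x + y) = ip z x + ip z y" for x y z
    using add[of x y z] by (simp add: commute)
  have scale': "ip y (r *\<^sub>R x) = r * ip y x" for x y r
    using scale[of r x y] by (simp add: commute)
  have sq: "(norm (x - r *\<^sub>R y))\<^sup>2 = (norm x)\<^sup>2 - 2 * r * ip x y + r\<^sup>2 * (norm y)\<^sup>2" for x y r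
  proof -
    have "ip (x + (-r) *\<^sub>R y) (x + (-r) *\<^sub>R y) = ip x x - 2 * r * ip x y + r\<^sup>2 * ip y y"
      unfolding add add' scale scale' using commute[of x y]
      by (simp add: power2_eq_square algebra_simps)
    then show ?thesis by (simp add: self)
  qed
  have par: "(norm (a - b))\<^sup>2 = 2 * (norm a)\<^sup>2 + 2 * (norm b)\<^sup>2 - 4 * (norm ((1/2) *\<^sub>R (a + b)))\<^sup>2" for a b :: 'a
  proof -
    have "(norm ((1/2) *\<^sub>R (a + b)))\<^sup>2 = (norm (a + b))\<^sup>2 / 4"
      by (simp add: power_divide)
    then show ?thesis using sq[of a 1 b] sq[of a "-1" b] by simp
  qed
  define D where "D = Inf ((\<lambda>s. (norm (p - s))\<^sup>2) ` S)"
  have S0: "S \<noteq> {}" using S(1) subspace_0 by blast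
  have Dle: "D \<le> (norm (p - s))\<^sup>2" if "s \<in> S" for s
    unfolding D_def using that by (intro cINF_lower bdd_belowI[of _ 0]) auto
  have "\<exists>s\<in>S. (norm (p - s))\<^sup>2 < D + 1 / real (Suc k)" for k
  proof -
    have "D < D + 1 / real (Suc k)" by simp
    then show ?thesis unfolding D_def
      by (subst (asm) cINF_less_iff) (use S0 in \<open>auto intro!: bdd_belowI[of _ 0]\<close>)
  qed
  then obtain y where y: "\<And>k. y k \<in> S" "\<And>k. (norm (p - y k))\<^sup>2 < D + 1 / real (Suc k)"
    by metis
  have "Cauchy y"
  proof (rule CauchyI)
    fix e :: real assume e: "0 < e"
    then obtain K where K: "1 / real (Suc K) < e\<^sup>2 / 4"
      using reals_Archimedean[of "e\<^sup>2/4"] by (auto simp: inverse_eq_divide)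
    have lt: "(norm (p - y k))\<^sup>2 < D + e\<^sup>2 / 4" if "K \<le> k" for k
    proof -
      have "1 / real (Suc k) \<le> 1 / real (Suc K)" using that by (simp add: frac_le)
      then show ?thesis using y(2)[of k] K by linarith
    qed
    show "\<exists>M. \<forall>m\<ge>M. \<forall>n\<ge>M. norm (y m - y n) < e"
    proof (intro exI allI impI)
      fix m n assume mn: "K \<le> m" "K \<le> n"
      \<comment> \<open>The midpoint has squared distance at least \<open>D\<close> from
        \<open>p\<close>, so the parallelogram law bounds the squared gap by 4(D + e^2/4) - 4D =
        e^2.\<close>
      have mid: "(1/2) *\<^sub>R (y m + y n) \<in> S"
        using S(1) y(1) by (simp add: subspace_add subspace_scale)
      have eq: "(1/2) *\<^sub>R ((p - y n) + (p - y m)) = p - (1/2) *\<^sub>R (y m + y n)"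
      proof -
        have "(1/2) *\<^sub>R ((p - y n) + (p - y m)) = (1/2) *\<^sub>R p + (1/2) *\<^sub>R p - (1/2) *\<^sub>R (y m + y n)"
          by (simp add: algebra_simps)
        also have "(1/2) *\<^sub>R p + (1/2) *\<^sub>R p = p" by (simp flip: scaleR_add_left)
        finally show ?thesis .
      qed
      have "(norm (y m - y n))\<^sup>2 < e\<^sup>2"
        using par[of "p - y n" "p - y m"] Dle[OF mid] lt[OF mn(1)] lt[OF mn(2)] unfolding eq by simp
      then show "norm (y m - y n) < e" using e by (simp add: power2_less_imp_less)
    qed
  qed
  then obtain q where q: "y \<longlonglongrightarrow> q" using Cauchy_convergent_iff convergent_def by blast
  have qS: "q \<in> S" using S(2) y(1) q closed_sequentially by blast
  have "(norm (p - q))\<^sup>2 \<le> D"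
  proof (rule LIMSEQ_le)
    show "(\<lambda>k. (norm (p - y k))\<^sup>2) \<longlonglongrightarrow> (norm (p - q))\<^sup>2" by (intro tendsto_intros q)
    show "(\<lambda>k. D + 1 / real (Suc k)) \<longlonglongrightarrow> D"
      using LIMSEQ_inverse_real_of_nat_add[of D] by (simp add: inverse_eq_divide)
    show "\<exists>N. \<forall>n\<ge>N. (norm (p - y n))\<^sup>2 \<le> D + 1 / real (Suc n)" using y(2) less_imp_le by blast
  qed
  then have min: "(norm (p - q))\<^sup>2 \<le> (norm (p - q - r *\<^sub>R s))\<^sup>2" if "s \<in> S" for s r
    using Dle[of "q + r *\<^sub>R s"] that qS S(1)
    by (metis (no_types) diff_diff_eq order_trans subspace_add subspace_scale)
  have "ip (p - q) s = 0" if s: "s \<in> S" for s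
  proof (cases "s = 0")
    case True
    then show ?thesis using scale'[of "p - q" 0 s] by simp
  next
    case False
    define c where "c = ip (p - q) s"
    have n: "(norm s)\<^sup>2 > 0" using False by simp
    \<comment> \<open>The value c / |s|^2 of \<open>r\<close> minimises the quadratic in
      \<open>r\<close>.\<close>
    have "0 \<le> - 2 * (c / (norm s)\<^sup>2) * c + (c / (norm s)\<^sup>2)\<^sup>2 * (norm s)\<^sup>2"
      using min[OF s, of "c / (norm s)\<^sup>2"] unfolding sq c_def by simp
    also have "\<dots> = - (c\<^sup>2 / (norm s)\<^sup>2)" using n by (simp add: power2_eq_square field_simps)
    finally have "c\<^sup>2 / (norm s)\<^sup>2 \<le> 0" by simp
    then have "c\<^sup>2 \<le> 0" using n by (simp add: divide_le_0_iff)
    then show ?thesis by (simp add: c_def)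
  qed
  then show ?thesis using qS by blast
qed

lemma subspace_closure:
  fixes S :: "'a::real_normed_vector set"
  assumes S: "subspace S"
  shows "subspace (closure S)"
proof (rule subspaceI)
  show "0 \<in> closure S" using S closure_subset subspace_0 by blast
next
  fix x y assume "x \<in> closure S" "y \<in> closure S"
  then obtain f g where "\<forall>n. f n \<in> S" "f \<longlonglongrightarrow> x" "\<forall>n. g n \<in> S" "g \<longlonglongrightarrow> y"
    unfolding closure_sequential by blast
  then show "x + y \<in> closure S"
    unfolding closure_sequential using S
    by (intro exI[of _ "\<lambda>n. f n + g n"]) (auto intro: tendsto_add subspace_add)
next
  fix c x assume "x \<in> closure S"
  then obtain f where "\<forall>n. f n \<in> S" "f \<longlonglongrightarrow> x"
    unfolding closure_sequential by blast
  then show "c *\<^sub>R x \<in> closure S"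
    unfolding closure_sequential using S
    by (intro exI[of _ "\<lambda>n. c *\<^sub>R f n"]) (auto intro: tendsto_scaleR subspace_scale)
qed

lemma rin_projection_exists:
  assumes "subspace S" "closed S"
  shows "\<exists>q\<in>S. \<forall>s\<in>S. rin (p - q) s = 0"
  by (rule orthogonal_projection_exists[OF rin_add_left rin_scaleR_left rin_commute rin_self assms])

lemma rin_prod_projection_exists:
  fixes S :: "('a::complex_hilbert \<times> 'b::complex_hilbert) set"
  assumes "subspace S" "closed S"
  shows "\<exists>q\<in>S. \<forall>s\<in>S. rin (fst (p - q)) (fst s) + rin (snd (p - q)) (snd s) = 0"
proof (rule orthogonal_projection_exists[OF _ _ _ _ assms,
        where ip = "\<lambda>a b. rin (fst a) (fst b) + rin (snd a) (snd b)"])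
  show "rin (fst x) (fst y) + rin (snd x) (snd y) = rin (fst y) (fst x) + rin (snd y) (snd x)"
    for x y :: "'a \<times> 'b"
    using rin_commute[of "fst x" "fst y"] rin_commute[of "snd x" "snd y"] by simp
qed (simp_all add: rin_add_left rin_scaleR_left rin_self norm_prod_def distrib_left)

subsection \<open>Unbounded operators\<close>

lemma graph_op_iff: "(x, u) \<in> graph_op T \<longleftrightarrow> T x = Some u"
  by (auto simp: graph_op_def)

lemma linear_op_zero: "linear_op T \<Longrightarrow> T 0 = Some 0"
proof -
  assume T: "linear_op T"
  then obtain u where u: "T 0 = Some u" by (auto simp: linear_op_def)
  then have "the (T (0 + 0)) = the (T 0) + the (T 0)"
    using T unfolding linear_op_def by blast
  then show ?thesis using u by simp
qed

lemma linear_op_add: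
  assumes "linear_op T" "T x = Some u" "T y = Some v"
  shows "T (x + y) = Some (u + v)"
  using assms unfolding linear_op_def by (metis domI domD option.sel)

lemma linear_op_scaleC:
  assumes "linear_op T" "T x = Some u"
  shows "T (c *\<^sub>C x) = Some (c *\<^sub>C u)"
  using assms unfolding linear_op_def by (metis domI domD option.sel)

lemma linear_op_scaleR: "linear_op T \<Longrightarrow> T x = Some u \<Longrightarrow> T (r *\<^sub>R x) = Some (r *\<^sub>R u)"
  unfolding scaleR_scaleC by (rule linear_op_scaleC)

lemma linear_op_diff:
  assumes "linear_op T" "T x = Some u" "T y = Some v"
  shows "T (x - y) = Some (u - v)"
  using linear_op_add[OF assms(1,2) linear_op_scaleR[OF assms(1,3), of "-1"]] by simp

lemma subspace_graph_op: "linear_op T \<Longrightarrow> subspace (graph_op T)"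
  by (auto simp: subspace_def graph_op_iff zero_prod_def linear_op_zero linear_op_add linear_op_scaleR)

lemma dense_orthogonal_zero:
  assumes "closure D = UNIV" "\<And>x. x \<in> D \<Longrightarrow> rin x z = 0"
  shows "z = 0"
proof -
  have "closed {x. rin x z = 0}"
    by (intro closed_Collect_eq continuous_intros rin.continuous_on)
  then have "closure D \<subseteq> {x. rin x z = 0}"
    using assms(2) by (intro closure_minimal) auto
  then have "rin z z = 0" using assms(1) by auto
  then show ?thesis by (simp add: rin_self)
qed

text \<open>The real part of the defining identity at i x carries its imaginary part at x, so
  \<open>rin\<close> suffices. Density of the domain makes \<open>z\<close> unique, which pins down
  the value chosen by \<open>SOME\<close>.\<close>

lemma adjoint_op_iff:
  fixes T :: "'a::complex_hilbert \<rightharpoonup> 'b::complex_hilbert"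
  assumes T: "linear_op T" "densely_defined T"
  shows "adjoint_op T y = Some z \<longleftrightarrow> (\<forall>x u. T x = Some u \<longrightarrow> rin u y = rin x z)"
proof -
  have eq: "(\<forall>x\<in>dom T. cinner (the (T x)) y = cinner x z) \<longleftrightarrow> (\<forall>x u. T x = Some u \<longrightarrow> rin u y = rin x z)"
    (is "?L z \<longleftrightarrow> ?R z") for z
  proof
    assume "?L z"
    then show "?R z" unfolding rin_def by (metis domI option.sel)
  next
    assume R: "?R z"
    show "?L z"
    proof
      fix x assume "x \<in> dom T"
      then obtain u where u: "T x = Some u" by blast
      have "rin u y = rin x z" "rin (\<i> *\<^sub>C u) y = rin (\<i> *\<^sub>C x) z"
        using R u linear_op_scaleC[OF T(1) u] by blast+
      then show "cinner (the (T x)) y = cinner x z"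
        using u by (simp add: complex_eq_iff Im_cinner_eq_rin rin_def[symmetric])
    qed
  qed
  define P where "P z \<longleftrightarrow> ?R z" for z
  have uniq: "z = z'" if "P z" "P z'" for z z'
  proof -
    have "rin x (z - z') = 0" if "x \<in> dom T" for x
      using \<open>P z\<close> \<open>P z'\<close> that by (auto simp: P_def rin.diff_right)
    then show ?thesis
      using dense_orthogonal_zero[of "dom T" "z - z'"] T(2) by (simp add: densely_defined_def)
  qed
  have adj: "adjoint_op T y = (if \<exists>z. P z then Some (SOME z. P z) else None)"
    unfolding adjoint_op_def eq P_def ..
  have "adjoint_op T y = Some z \<longleftrightarrow> P z"
  proof (cases "\<exists>z. P z")
    case True
    then have "P (SOME z. P z)" by (rule someI_ex)
    then show ?thesis using adj uniq True by auto
  qed (use adj in auto)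
  then show ?thesis unfolding P_def .
qed

lemma adjoint_op_rin:
  assumes "linear_op T" "densely_defined T" "adjoint_op T y = Some z" "T x = Some u"
  shows "rin u y = rin x z"
  using assms(3,4) unfolding adjoint_op_iff[OF assms(1,2)] by simp

section \<open>The operator T*T and its resolvent\<close>

definition gram :: "('a::complex_hilbert \<rightharpoonup> 'b::complex_hilbert) \<Rightarrow> ('a \<rightharpoonup> 'a)" where
  "gram T = adjoint_op T \<circ>\<^sub>m T"

text \<open>This is (1 + T*T)^(-1): the equation for g reads g + T*Tg = h.\<close>

definition gram_resolvent :: "('a::complex_hilbert \<rightharpoonup> 'b::complex_hilbert) \<Rightarrow> 'a \<Rightarrow> 'a" where
  "gram_resolvent T h = (THE g. gram T g = Some (h - g))"

lemma gram_Some_iff: "gram T g = Some r \<longleftrightarrow> (\<exists>u. T g = Some u \<and> adjoint_op T u = Some r)"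
  by (auto simp: gram_def map_comp_Some_iff)

locale closed_dense_op =
  fixes T :: "'a::complex_hilbert \<rightharpoonup> 'b::complex_hilbert"
  assumes linear: "linear_op T" and closed: "closed_op T" and dense: "densely_defined T"
begin

lemmas adj_iff = adjoint_op_iff[OF linear dense]
lemmas adj_rin = adjoint_op_rin[OF linear dense]

lemma gram_iff:
  "gram T g = Some r \<longleftrightarrow> (\<exists>u. T g = Some u \<and> (\<forall>x v. T x = Some v \<longrightarrow> rin v u = rin x r))"
  by (simp add: gram_Some_iff adj_iff)

lemma gram_add:
  assumes "gram T g = Some r" "gram T g' = Some r'"
  shows "gram T (g + g') = Some (r + r')"
proof -
  obtain u u' where u: "T g = Some u" "\<And>x v. T x = Some v \<Longrightarrow> rin v u = rin x r"
    and u': "T g' = Some u'" "\<And>x v. T x = Some v \<Longrightarrow> rin v u' = rin x r'"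
    using assms unfolding gram_iff by blast
  show ?thesis
    unfolding gram_iff using linear_op_add[OF linear u(1) u'(1)] u(2) u'(2)
    by (auto simp: rin.add_right intro!: exI[of _ "u + u'"])
qed

lemma gram_scaleR:
  assumes "gram T g = Some r"
  shows "gram T (c *\<^sub>R g) = Some (c *\<^sub>R r)"
proof -
  obtain u where u: "T g = Some u" "\<And>x v. T x = Some v \<Longrightarrow> rin v u = rin x r"
    using assms unfolding gram_iff by blast
  show ?thesis
    unfolding gram_iff using linear_op_scaleR[OF linear u(1)] u(2)
    by (auto simp: rin.scaleR_right intro!: exI[of _ "c *\<^sub>R u"])
qed

lemma gram_diff: "gram T g = Some r \<Longrightarrow> gram T g' = Some r' \<Longrightarrow> gram T (g - g') = Some (r - r')"
  using gram_add[of g r "-1 *\<^sub>R g'"  "-1 *\<^sub>R r'"] gram_scaleR[of g' r' "-1"] by simp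

lemma gram_rin_nonneg: "gram T g = Some r \<Longrightarrow> 0 \<le> rin g r"
  unfolding gram_iff by (metis rin_self zero_le_power2)

lemma gram_symmetric:
  assumes "gram T g = Some r" "gram T g' = Some r'"
  shows "rin g r' = rin r g'"
proof -
  obtain u u' where "T g = Some u" "\<And>x v. T x = Some v \<Longrightarrow> rin v u = rin x r"
    and "T g' = Some u'" "\<And>x v. T x = Some v \<Longrightarrow> rin v u' = rin x r'"
    using assms unfolding gram_iff by blast
  then show ?thesis using rin_commute[of u u'] rin_commute[of r g'] by metis
qed

text \<open>Von Neumann's argument: project (h, 0) onto the closed graph. The projection is some (g,
  Tg), and orthogonality of the residual (h - g, -Tg) to the graph says that T*Tg = h - g.\<close>

lemma gram_resolvent_exists: "\<exists>g. gram T g = Some (h - g)"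
proof -
  obtain q where q: "q \<in> graph_op T"
    "\<forall>s\<in>graph_op T. rin (fst ((h, 0) - q)) (fst s) + rin (snd ((h, 0) - q)) (snd s) = 0"
    using rin_prod_projection_exists[OF subspace_graph_op[OF linear]] closed
    unfolding closed_op_def by blast
  obtain g u where gu: "q = (g, u)" by fastforce
  have "rin v u = rin x (h - g)" if "T x = Some v" for x v
    using q(2)[rule_format, of "(x, v)"] that
    by (simp add: gu graph_op_iff rin.minus_left rin.minus_right rin_commute)
  then have "gram T g = Some (h - g)"
    unfolding gram_iff using q(1) gu by (auto simp: graph_op_iff)
  then show ?thesis by blast
qed

lemma gram_resolvent_unique:
  assumes "gram T g = Some (h - g)" "gram T g' = Some (h - g')"
  shows "g = g'"
proof -
  have "gram T (g - g') = Some (- (g - g'))" using gram_diff[OF assms] by simp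
  then have "rin (g - g') (g - g') \<le> 0"
    using gram_rin_nonneg[of "g - g'" "- (g - g')"] rin.minus_right[of "g - g'" "g - g'"] by simp
  then show ?thesis by (simp add: rin_self)
qed

lemma gram_resolvent: "gram T (gram_resolvent T h) = Some (h - gram_resolvent T h)"
  unfolding gram_resolvent_def using gram_resolvent_exists gram_resolvent_unique
  by (metis (mono_tags, lifting) theI')

lemma gram_resolvent_eqI: "gram T g = Some r \<Longrightarrow> gram_resolvent T (g + r) = g"
  by (rule gram_resolvent_unique[OF gram_resolvent]) simp

lemma gram_resolvent_add: "gram_resolvent T (x + y) = gram_resolvent T x + gram_resolvent T y"
  using gram_resolvent_eqI[OF gram_add[OF gram_resolvent gram_resolvent]] by (simp add: algebra_simps)

lemma gram_resolvent_scaleR: "gram_resolvent T (c *\<^sub>R x) = c *\<^sub>R gram_resolvent T x"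
  using gram_resolvent_eqI[OF gram_scaleR[OF gram_resolvent]] by (simp add: algebra_simps)

lemma gram_resolvent_eq_0: "gram_resolvent T x = 0 \<longleftrightarrow> x = 0"
proof
  assume "gram_resolvent T x = 0"
  then have "gram T (0 *\<^sub>R 0) = Some (0 *\<^sub>R x)"
    using gram_resolvent[of x] gram_scaleR[of 0 x 0] by simp
  then show "x = 0" using gram_resolvent[of x] \<open>gram_resolvent T x = 0\<close> by simp
next
  assume "x = 0"
  then show "gram_resolvent T x = 0" using gram_resolvent_scaleR[of 0 x] by simp
qed

lemma gram_resolvent_selfadjoint: "rin (gram_resolvent T x) y = rin x (gram_resolvent T y)"
  using gram_symmetric[OF gram_resolvent gram_resolvent, of x y]
  by (simp add: rin.diff_left rin.diff_right)

lemma gram_resolvent_nonneg: "0 \<le> rin (gram_resolvent T x) x"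
  using gram_rin_nonneg[OF gram_resolvent, of x] rin_self[of "gram_resolvent T x"]
  by (simp add: rin.diff_right) (metis order_trans zero_le_power2)

text \<open>With g the resolvent at x, <x - g, x> = <x - g, g> + |x - g|^2, and the first term is
  <T*Tg, g> >= 0.\<close>

lemma gram_resolvent_le: "rin (gram_resolvent T x) x \<le> rin x x"
proof -
  let ?g = "gram_resolvent T x"
  have "0 \<le> rin ?g (x - ?g) + rin (x - ?g) (x - ?g)"
    using gram_rin_nonneg[OF gram_resolvent, of x] by (simp add: rin_self)
  then show ?thesis using rin_commute[of ?g x] by (simp add: rin.diff_right rin.diff_left)
qed

text \<open>The domain of the Gram operator is a core: a graph vector orthogonal to the restriction
  has its first component orthogonal to the range of \<open>1 + T\<^sup>*T\<close>, which is everything.\<close>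

lemma gram_core:
  assumes "T x = Some u"
  shows "(x, u) \<in> closure {(y, v). T y = Some v \<and> gram T y \<noteq> None}" (is "_ \<in> closure ?S")
proof -
  have S: "subspace ?S"
  proof (rule subspaceI)
    have "gram T 0 = Some 0"
      using gram_scaleR[OF gram_resolvent, of 0 0] by simp
    then show "0 \<in> ?S" using linear_op_zero[OF linear] by (simp add: zero_prod_def)
  next
    fix p q assume "p \<in> ?S" "q \<in> ?S"
    then show "p + q \<in> ?S" using linear_op_add[OF linear] gram_add by (force simp: not_None_eq)
  next
    fix c p assume "p \<in> ?S"
    then show "c *\<^sub>R p \<in> ?S" using linear_op_scaleR[OF linear] gram_scaleR by (force simp: not_None_eq)
  qed
  obtain q where q: "q \<in> closure ?S"
    "\<forall>s\<in>closure ?S. rin (fst ((x, u) - q)) (fst s) + rin (snd ((x, u) - q)) (snd s) = 0"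
    using rin_prod_projection_exists[of "closure ?S" "(x, u)"] subspace_closure[OF S] by blast
  obtain y v where yv: "q = (y, v)" by fastforce
  have "closure ?S \<subseteq> graph_op T"
    using closed unfolding closed_op_def by (intro closure_minimal) (auto simp: graph_op_iff)
  then have Ty: "T y = Some v" using q(1) yv by (auto simp: graph_op_iff)
  then have Td: "T (x - y) = Some (u - v)" using linear_op_diff[OF linear] assms by blast
  let ?g = "gram_resolvent T (x - y)"
  obtain w where w: "T ?g = Some w" "\<forall>z v. T z = Some v \<longrightarrow> rin v w = rin z (x - y - ?g)"
    using gram_resolvent[of "x - y"] unfolding gram_iff by blast
  have "(?g, w) \<in> closure ?S"
    using w(1) gram_resolvent[of "x - y"] closure_subset[of ?S] by auto
  then have "rin (x - y) ?g + rin (u - v) w = 0" using q(2) yv by fastforce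
  moreover have "rin (u - v) w = rin (x - y) (x - y - ?g)" using w(2) Td by blast
  ultimately have "rin (x - y) (x - y) = 0" by (simp add: rin.diff_right)
  then have "x = y" by (simp add: rin_self)
  then show ?thesis using q(1) yv Ty assms by simp
qed

end

subsection \<open>Polynomials of a positive contraction\<close>

text \<open>The ratios are the Bernstein coefficients of t^j in degree m; they approach the values
  of t^j at k/m uniformly in k. Passing from j to j + 1 multiplies the ratio by (k - j)/(m - j),
  which is within j/(m - j) of k/m.\<close>

lemma binomial_ratio_tendsto_power:
  fixes e :: real
  assumes "0 < e"
  shows "\<forall>\<^sub>F m in sequentially. \<forall>k\<le>m. \<bar>real (k choose j) / real (m choose j) - (real k / real m) ^ j\<bar> < e"
  using assms
proof (induction j arbitrary: e)
  case 0
  then show ?case by simp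
next
  case (Suc j)
  have ev1: "\<forall>\<^sub>F m in sequentially. \<forall>k\<le>m. \<bar>real (k choose j) / real (m choose j) - (real k / real m) ^ j\<bar> < e / 2"
    using Suc.prems by (intro Suc.IH) simp
  have "(\<lambda>m. real j / (real m - real j)) \<longlonglongrightarrow> 0"
    using tendsto_divide_0[OF tendsto_const filterlim_at_top_imp_at_infinity[OF
        filterlim_tendsto_add_at_top[OF tendsto_const filterlim_real_sequentially]], of "real j" "- real j"]
    by (simp add: algebra_simps)
  then have ev2: "\<forall>\<^sub>F m in sequentially. real j / (real m - real j) < e / 2"
    using Suc.prems by (intro order_tendstoD) auto
  have ev3: "\<forall>\<^sub>F m in sequentially. m > j" by (rule eventually_gt_at_top)
  from ev1 ev2 ev3 show ?case
  proof eventually_elim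
    case (elim m)
    show ?case
    proof (intro allI impI)
      fix k assume k: "k \<le> m"
      define c where "c i = real (k choose i) / real (m choose i)" for i
      define d where "d = real k / real m"
      define d' where "d' = (real k - real j) / (real m - real j)"
      \<comment> \<open>Real subtraction keeps this recursion valid for i < j, where both binomials
        vanish.\<close>
      have suc: "real (i choose Suc j) = real (i choose j) * (real i - real j) / real (Suc j)" for i
      proof (cases "j \<le> i")
        case True
        have "Suc j * (i choose Suc j) = (i - j) * (i choose j)"
          by (metis Suc_times_binomial_add add.commute binomial_absorb_comp binomial_absorption diff_Suc_1 mult.commute)
        then have "real (Suc j) * real (i choose Suc j) = real (i - j) * real (i choose j)"
          by (metis of_nat_mult)
        then show ?thesis using True by (simp add: of_nat_diff field_simps)
      qed (simp add: binomial_eq_0)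
      have c: "c (Suc j) = c j * d'"
        unfolding c_def d'_def suc by simp
      have c01: "0 \<le> c j" "c j \<le> 1"
        using k binomial_right_mono[of k m j] elim(3) by (auto simp: c_def divide_le_eq_1)
      have d01: "0 \<le> d" "d \<le> 1"
        using k elim(3) by (auto simp: d_def)
      have "d - d' = real j * (real m - real k) / (real m * (real m - real j))"
        using elim(3) by (simp add: d_def d'_def field_simps)
      also have "\<dots> = (real j / (real m - real j)) * ((real m - real k) / real m)"
        by simp
      finally have dd: "d - d' = (real j / (real m - real j)) * ((real m - real k) / real m)" .
      have f: "0 \<le> (real m - real k) / real m" "(real m - real k) / real m \<le> 1"
        using k elim(3) by auto
      have g: "0 \<le> real j / (real m - real j)" using elim(3) by simp
      have "\<bar>d' - d\<bar> \<le> real j / (real m - real j)"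
        using dd mult_left_mono[OF f(2) g] mult_nonneg_nonneg[OF g f(1)] by simp
      then have "\<bar>d' - d\<bar> < e / 2" using elim(2) by linarith
      moreover have "\<bar>c j - d ^ j\<bar> < e / 2" using elim(1) k by (simp add: c_def d_def)
      moreover have "c (Suc j) - d ^ Suc j = c j * (d' - d) + d * (c j - d ^ j)"
        by (simp add: c algebra_simps)
      moreover have "\<bar>c j * (d' - d)\<bar> \<le> \<bar>d' - d\<bar>" "\<bar>d * (c j - d ^ j)\<bar> \<le> \<bar>c j - d ^ j\<bar>"
        using c01 d01 by (auto simp: abs_mult intro: mult_left_le_one_le)
      ultimately have "\<bar>c (Suc j) - d ^ Suc j\<bar> < e" by linarith
      then show "\<bar>real (k choose Suc j) / real (m choose Suc j) - (real k / real m) ^ Suc j\<bar> < e"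
        by (simp add: c_def d_def)
    qed
  qed
qed

text \<open>Terms with k < j vanish. In the others (m choose i+j)(i+j choose j) = (m choose j)(m-j
  choose i), which leaves x^j times the Bernstein partition of unity of degree m - j.\<close>

lemma power_eq_Bernstein_sum:
  assumes "j \<le> m"
  shows "(\<Sum>k\<le>m. real (k choose j) / real (m choose j) * Bernstein m k x) = x ^ j"
proof -
  have "(\<Sum>k\<le>m. real (k choose j) / real (m choose j) * Bernstein m k x)
      = (\<Sum>k=j..m. real (k choose j) / real (m choose j) * Bernstein m k x)"
    by (rule sum.mono_neutral_right) (auto simp: not_le binomial_eq_0)
  also have "\<dots> = (\<Sum>i=0..m-j. real ((i + j) choose j) / real (m choose j) * Bernstein m (i + j) x)"
    using assms sum.shift_bounds_cl_nat_ivl[of "\<lambda>k. real (k choose j) / real (m choose j) * Bernstein m k x" 0 j "m - j"]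
    by simp
  also have "\<dots> = (\<Sum>i\<le>m-j. x ^ j * Bernstein (m - j) i x)"
  proof (rule sum.cong)
    fix i assume i: "i \<in> {..m - j}"
    have "(m choose (i + j)) * ((i + j) choose j) = (m choose j) * ((m - j) choose i)"
      using choose_mult[of j "i + j" m] i assms by simp
    then have "real (m choose (i + j)) * real ((i + j) choose j) = real (m choose j) * real ((m - j) choose i)"
      by (metis of_nat_mult)
    moreover have "real (m choose j) \<noteq> 0" using assms by simp
    ultimately have "real ((i + j) choose j) / real (m choose j) * real (m choose (i + j)) = real ((m - j) choose i)"
      by (simp add: field_simps)
    then show "real ((i + j) choose j) / real (m choose j) * Bernstein m (i + j) x = x ^ j * Bernstein (m - j) i x"
      using i by (simp add: Bernstein_def power_add mult.assoc[symmetric]) (simp add: algebra_simps)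
  qed auto
  also have "\<dots> = x ^ j" by (simp flip: sum_distrib_left)
  finally show ?thesis .
qed

definition Bernstein_poly :: "nat \<Rightarrow> nat \<Rightarrow> real poly" where
  "Bernstein_poly m k = smult (real (m choose k)) ([:0, 1:] ^ k * [:1, -1:] ^ (m - k))"

lemma poly_Bernstein_poly [simp]: "poly (Bernstein_poly m k) x = Bernstein m k x"
  by (simp add: Bernstein_poly_def Bernstein_def poly_power)

lemma poly_eq_Bernstein_sum:
  fixes p :: "real poly"
  assumes "degree p \<le> m"
  shows "p = (\<Sum>k\<le>m. smult (\<Sum>j\<le>degree p. coeff p j * (real (k choose j) / real (m choose j))) (Bernstein_poly m k))"
    (is "p = ?q")
proof -
  have "poly ?q x = poly p x" for x
  proof -
    have "poly ?q x = (\<Sum>k\<le>m. \<Sum>j\<le>degree p. coeff p j * (real (k choose j) / real (m choose j) * Bernstein m k x))"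
      by (simp add: poly_sum sum_distrib_right mult.assoc)
    also have "\<dots> = (\<Sum>j\<le>degree p. coeff p j * (\<Sum>k\<le>m. real (k choose j) / real (m choose j) * Bernstein m k x))"
      by (subst sum.swap) (simp add: sum_distrib_left)
    also have "\<dots> = poly p x"
      unfolding poly_altdef using assms by (intro sum.cong refl arg_cong2[where f = "(*)"] power_eq_Bernstein_sum) auto
    finally show ?thesis .
  qed
  then have "poly ?q = poly p" by blast
  then show ?thesis by (simp add: poly_eq_poly_eq_iff)
qed

text \<open>In high degree the k-th Bernstein coefficient of p is within e of p(k/m), which is
  nonnegative.\<close>

lemma Bernstein_coeffs_ge:
  fixes p :: "real poly"
  assumes "\<And>t. 0 \<le> t \<Longrightarrow> t \<le> 1 \<Longrightarrow> 0 \<le> poly p t" and "0 < e"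
  shows "\<exists>m\<ge>degree p. \<forall>k\<le>m. - e \<le> (\<Sum>j\<le>degree p. coeff p j * (real (k choose j) / real (m choose j)))"
proof -
  \<comment> \<open>An error of e/C in each monomial adds up to at most e; the summand 1 keeps C
    positive.\<close>
  define C where "C = 1 + (\<Sum>j\<le>degree p. \<bar>coeff p j\<bar>)"
  have C: "C > 0" unfolding C_def by (intro add_pos_nonneg sum_nonneg) auto
  have "\<forall>\<^sub>F m in sequentially. \<forall>j\<in>{..degree p}. \<forall>k\<le>m. \<bar>real (k choose j) / real (m choose j) - (real k / real m) ^ j\<bar> < e / C"
    using assms(2) C by (intro eventually_ball_finite ballI binomial_ratio_tendsto_power) auto
  moreover have "\<forall>\<^sub>F m in sequentially. m > degree p" by (rule eventually_gt_at_top)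
  ultimately have "\<forall>\<^sub>F m in sequentially. m > degree p \<and> (\<forall>j\<in>{..degree p}. \<forall>k\<le>m. \<bar>real (k choose j) / real (m choose j) - (real k / real m) ^ j\<bar> < e / C)"
    by eventually_elim auto
  then obtain m where m: "m > degree p"
    "\<And>j k. j \<le> degree p \<Longrightarrow> k \<le> m \<Longrightarrow> \<bar>real (k choose j) / real (m choose j) - (real k / real m) ^ j\<bar> < e / C"
    by (auto simp: eventually_sequentially)
  have "- e \<le> (\<Sum>j\<le>degree p. coeff p j * (real (k choose j) / real (m choose j)))" if k: "k \<le> m" for k
  proof -
    let ?t = "real k / real m"
    have "0 \<le> poly p ?t" using assms(1) k m(1) by simp
    moreover have "\<bar>(\<Sum>j\<le>degree p. coeff p j * (real (k choose j) / real (m choose j))) - poly p ?t\<bar> \<le> e"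
    proof -
      have "(\<Sum>j\<le>degree p. coeff p j * (real (k choose j) / real (m choose j))) - poly p ?t
          = (\<Sum>j\<le>degree p. coeff p j * (real (k choose j) / real (m choose j) - ?t ^ j))"
        by (simp add: poly_altdef sum_subtractf right_diff_distrib)
      also have "\<bar>\<dots>\<bar> \<le> (\<Sum>j\<le>degree p. \<bar>coeff p j\<bar> * (e / C))"
        by (rule order_trans[OF sum_abs]) (auto simp: abs_mult simp del: times_divide_eq_right intro!: sum_mono mult_left_mono less_imp_le[OF m(2)] k)
      also have "\<dots> = (C - 1) * (e / C)"
        unfolding sum_distrib_right[symmetric] by (simp add: C_def)
      also have "\<dots> \<le> e" using C assms(2) by (simp add: field_simps)
      finally show ?thesis .
    qed
    ultimately show ?thesis by linarith
  qed
  then show ?thesis using m(1) less_imp_le by blast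
qed

lemma Weierstrass_poly:
  fixes f :: "real \<Rightarrow> real"
  assumes "continuous_on {0..1} f" "0 < e"
  shows "\<exists>p. \<forall>t. 0 \<le> t \<and> t \<le> 1 \<longrightarrow> \<bar>poly p t - f t\<bar> < e"
proof -
  obtain N where "\<And>n x. N \<le> n \<Longrightarrow> x \<in> {0..1} \<Longrightarrow> \<bar>f x - (\<Sum>k\<le>n. f (k / n) * Bernstein n k x)\<bar> < e"
    using Bernstein_Weierstrass[OF assms] by blast
  then show ?thesis
    by (intro exI[of _ "\<Sum>k\<le>N. smult (f (k / N)) (Bernstein_poly N k)"])
       (auto simp: poly_sum abs_minus_commute)
qed

text \<open>A Weierstrass approximation of 1/w within 1/(2M), where M bounds |w| on the unit
  interval.\<close>

lemma poly_approximate_inverse: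
  fixes w :: "real poly"
  assumes "\<And>t. 0 \<le> t \<Longrightarrow> t \<le> 1 \<Longrightarrow> 0 < poly w t"
  shows "\<exists>u. \<forall>t. 0 \<le> t \<and> t \<le> 1 \<longrightarrow> \<bar>1 - poly u t * poly w t\<bar> \<le> 1 / 2"
proof -
  have cont: "continuous_on {0..1} (poly w)" by (intro continuous_intros)
  then have "bounded (poly w ` {0..1})"
    by (simp add: compact_continuous_image compact_imp_bounded)
  then obtain M where M: "0 < M" "\<And>t. 0 \<le> t \<Longrightarrow> t \<le> 1 \<Longrightarrow> \<bar>poly w t\<bar> \<le> M"
    by (auto simp: bounded_pos)
  have "continuous_on {0..1} (\<lambda>t. inverse (poly w t))"
    using assms by (intro continuous_intros) force
  from Weierstrass_poly[OF this, of "1 / (2 * M)"] M(1)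
  obtain u where u: "\<And>t. 0 \<le> t \<Longrightarrow> t \<le> 1 \<Longrightarrow> \<bar>poly u t - inverse (poly w t)\<bar> < 1 / (2 * M)" by auto
  show ?thesis
  proof (intro exI allI impI)
    fix t :: real assume t: "0 \<le> t \<and> t \<le> 1"
    have "\<bar>1 - poly u t * poly w t\<bar> = \<bar>poly u t - inverse (poly w t)\<bar> * \<bar>poly w t\<bar>"
      using assms[of t] t by (subst abs_mult[symmetric]) (simp add: left_diff_distrib abs_minus_commute)
    also have "\<dots> \<le> 1 / (2 * M) * M"
      using u[of t] M t by (intro mult_mono) auto
    finally show "\<bar>1 - poly u t * poly w t\<bar> \<le> 1 / 2" using M(1) by simp
  qed
qed

section \<open>Polynomial functional calculus of a linear map\<close>

definition poly_op :: "('a::real_vector \<Rightarrow> 'a) \<Rightarrow> real poly \<Rightarrow> 'a \<Rightarrow> 'a" where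
  "poly_op J p x = (\<Sum>i\<le>degree p. coeff p i *\<^sub>R (J ^^ i) x)"

locale linear_endo = fixes J :: "'a::real_vector \<Rightarrow> 'a"
  assumes add: "J (x + y) = J x + J y" and scaleR: "J (r *\<^sub>R x) = r *\<^sub>R J x"
begin

lemma zero: "J 0 = 0"
  using scaleR[of 0 0] by simp

lemma poly_op_altdef:
  assumes "degree p \<le> m"
  shows "poly_op J p x = (\<Sum>i\<le>m. coeff p i *\<^sub>R (J ^^ i) x)"
  unfolding poly_op_def using assms
  by (intro sum.mono_neutral_left) (auto simp: coeff_eq_0)

lemma poly_op_zero: "poly_op J 0 x = 0"
  by (simp add: poly_op_def)

lemma poly_op_add: "poly_op J (p + q) x = poly_op J p x + poly_op J q x"
proof -
  let ?m = "max (degree p) (degree q)"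
  have "degree (p + q) \<le> ?m" by (rule degree_add_le_max)
  then show ?thesis
    by (simp add: poly_op_altdef[of _ ?m] scaleR_add_left sum.distrib)
qed

lemma poly_op_smult: "poly_op J (smult c p) x = c *\<^sub>R poly_op J p x"
  by (simp add: poly_op_altdef[OF degree_smult_le] poly_op_def scaleR_sum_right)

lemma J_sum: "finite A \<Longrightarrow> J (\<Sum>i\<in>A. f i) = (\<Sum>i\<in>A. J (f i))"
  by (induction A rule: finite_induct) (auto simp: add zero)

lemma poly_op_pCons: "poly_op J (pCons a p) x = a *\<^sub>R x + J (poly_op J p x)"
proof -
  have "poly_op J (pCons a p) x = (\<Sum>i\<le>Suc (degree p). coeff (pCons a p) i *\<^sub>R (J ^^ i) x)"
    by (rule poly_op_altdef) (rule degree_pCons_le)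
  also have "\<dots> = a *\<^sub>R x + (\<Sum>i\<le>degree p. coeff p i *\<^sub>R J ((J ^^ i) x))"
    by (subst sum.atMost_Suc_shift) simp
  also have "(\<Sum>i\<le>degree p. coeff p i *\<^sub>R J ((J ^^ i) x)) = J (poly_op J p x)"
    unfolding poly_op_def by (simp add: J_sum scaleR)
  finally show ?thesis .
qed

lemma poly_op_mult: "poly_op J (p * q) x = poly_op J p (poly_op J q x)"
  by (induction p) (simp_all add: poly_op_zero poly_op_pCons poly_op_add poly_op_smult)

lemma poly_op_one: "poly_op J 1 x = x"
  by (simp add: poly_op_def)

lemma poly_op_X: "poly_op J [:0, 1:] x = J x"
  by (simp add: poly_op_pCons poly_op_zero zero)

lemma poly_op_1_minus_X: "poly_op J [:1, -1:] x = x - J x"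
  using scaleR[of "-1" x] by (simp add: poly_op_pCons poly_op_zero zero)

lemma poly_op_diff: "poly_op J (p - q) x = poly_op J p x - poly_op J q x"
  using poly_op_add[of p "smult (-1) q" x] poly_op_smult[of "-1" q x] by simp

lemma poly_op_sum: "finite A \<Longrightarrow> poly_op J (\<Sum>i\<in>A. f i) x = (\<Sum>i\<in>A. poly_op J (f i) x)"
  by (induction A rule: finite_induct) (auto simp: poly_op_zero poly_op_add)

lemma poly_op_add_arg: "poly_op J p (x + y) = poly_op J p x + poly_op J p y"
  by (induction p) (simp_all add: poly_op_zero poly_op_pCons add scaleR_add_right)

lemma poly_op_scaleR_arg: "poly_op J p (r *\<^sub>R x) = r *\<^sub>R poly_op J p x"
  by (induction p) (simp_all add: poly_op_zero poly_op_pCons scaleR scaleR_add_right)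

lemma poly_op_diff_arg: "poly_op J p (x - y) = poly_op J p x - poly_op J p y"
  using poly_op_add_arg[of p x "-1 *\<^sub>R y"] poly_op_scaleR_arg[of p "-1" y] by simp

lemma poly_op_commute: "poly_op J p (poly_op J q x) = poly_op J q (poly_op J p x)"
  by (simp add: poly_op_mult[symmetric] mult.commute)

lemma poly_op_invariant:
  assumes "subspace S" "\<And>x. x \<in> S \<Longrightarrow> J x \<in> S" "x \<in> S"
  shows "poly_op J p x \<in> S"
  using assms
  by (induction p) (auto simp: poly_op_zero poly_op_pCons subspace_0 subspace_add subspace_scale)

end

text \<open>The conditions say that J is self-adjoint with 0 <= J <= 1 as forms. Continuity of J is
  not assumed but follows from the norm bound for polynomials of J.\<close>

locale positive_contraction = linear_endo J
  for J :: "'a::complex_hilbert \<Rightarrow> 'a" +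
  assumes selfadjoint: "rin (J x) y = rin x (J y)"
    and nonneg: "0 \<le> rin (J x) x"
    and le: "rin (J x) x \<le> rin x x"
begin

lemma poly_op_selfadjoint: "rin (poly_op J p x) y = rin x (poly_op J p y)"
proof (induction p arbitrary: y)
  case 0
  then show ?case by (simp add: poly_op_zero rin.zero_left rin.zero_right)
next
  case (pCons a p)
  have "poly_op J p (J y) = J (poly_op J p y)"
    using poly_op_commute[of p "[:0, 1:]" y] by (simp add: poly_op_X)
  then show ?case
    by (simp add: poly_op_pCons pCons.IH selfadjoint rin.add_left rin.add_right rin.scaleR_left rin.scaleR_right)
qed

lemma poly_op_conj_nonneg:
  assumes "\<And>x. 0 \<le> rin (poly_op J p x) x"
  shows "0 \<le> rin (poly_op J (q * p * q) x) x"
proof -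
  have "rin (poly_op J (q * p * q) x) x = rin (poly_op J p (poly_op J q x)) (poly_op J q x)"
    by (simp add: poly_op_mult poly_op_selfadjoint[of q])
  then show ?thesis using assms by simp
qed

text \<open>Splitting off the largest even powers writes the product as q r q with r one of 1, X, Y,
  XY for X = J and Y = 1 - J. Conjugation by the self-adjoint q preserves positivity, so only these
  four cases matter.\<close>

lemma poly_op_Bernstein_nonneg: "0 \<le> rin (poly_op J ([:0, 1:] ^ k * [:1, -1:] ^ l) x) x"
proof -
  let ?X = "[:0, 1:] :: real poly" and ?Y = "[:1, -1:] :: real poly"
  have X: "0 \<le> rin (poly_op J ?X x) x" and Y: "0 \<le> rin (poly_op J ?Y x) x" for x
    using nonneg le[of x] by (simp_all add: poly_op_X poly_op_1_minus_X rin.diff_left)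
  have XY: "0 \<le> rin (poly_op J (?X * ?Y) x) x" for x
  proof -
    \<comment> \<open>Since X + Y = 1, XY = XY(X + Y) is a sum of two conjugates of positive
      operators.\<close>
    have "?X * ?Y = ?Y * ?X * ?Y + ?X * ?Y * ?X" by simp
    then have "rin (poly_op J (?X * ?Y) x) x
        = rin (poly_op J (?Y * ?X * ?Y) x) x + rin (poly_op J (?X * ?Y * ?X) x) x"
      by (metis poly_op_add rin.add_left)
    then show ?thesis
      using poly_op_conj_nonneg[OF X, of ?Y x] poly_op_conj_nonneg[OF Y, of ?X x] by linarith
  qed
  have one: "0 \<le> rin (poly_op J 1 x) x" for x by (simp add: poly_op_one rin_self)
  have small: "0 \<le> rin (poly_op J (?X ^ (k mod 2) * ?Y ^ (l mod 2)) x) x" for x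
  proof -
    consider "k mod 2 = 0" "l mod 2 = 0" | "k mod 2 = 0" "l mod 2 = 1"
      | "k mod 2 = 1" "l mod 2 = 0" | "k mod 2 = 1" "l mod 2 = 1" by linarith
    then show ?thesis
      by cases (simp_all only: power_0 power_one_right mult_1_left mult_1_right X Y XY one)
  qed
  have sq: "p ^ m = p ^ (m div 2) * p ^ (m mod 2) * p ^ (m div 2)" for p :: "real poly" and m
  proof -
    have "m = m div 2 + m mod 2 + m div 2" by presburger
    then show ?thesis by (metis power_add)
  qed
  have "?X ^ k * ?Y ^ l = (?X ^ (k div 2) * ?Y ^ (l div 2)) * (?X ^ (k mod 2) * ?Y ^ (l mod 2)) * (?X ^ (k div 2) * ?Y ^ (l div 2))"
    by (subst sq[of ?X k], subst sq[of ?Y l]) (simp only: mult_ac)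
  then show ?thesis using poly_op_conj_nonneg[OF small] by metis
qed

text \<open>Bernstein polynomials of J are positive and sum to the identity, so coefficients at
  least -e bound the form of p(J) below by -e|x|^2; then e tends to 0.\<close>

lemma poly_op_nonneg:
  assumes "\<And>t. 0 \<le> t \<Longrightarrow> t \<le> 1 \<Longrightarrow> 0 \<le> poly p t"
  shows "0 \<le> rin (poly_op J p x) x"
proof -
  have "- (e * rin x x) \<le> rin (poly_op J p x) x" if e: "0 < e" for e
  proof -
    obtain m where m: "degree p \<le> m"
      "\<And>k. k \<le> m \<Longrightarrow> - e \<le> (\<Sum>j\<le>degree p. coeff p j * (real (k choose j) / real (m choose j)))"
      using Bernstein_coeffs_ge[OF assms e] by blast
    define b where "b k = (\<Sum>j\<le>degree p. coeff p j * (real (k choose j) / real (m choose j)))" for k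
    have p: "p = (\<Sum>k\<le>m. smult (b k) (Bernstein_poly m k))"
      unfolding b_def by (rule poly_eq_Bernstein_sum[OF m(1)])
    have "poly 1 = poly (\<Sum>k\<le>m. Bernstein_poly m k)"
      by (simp add: fun_eq_iff poly_sum)
    then have one: "(1::real poly) = (\<Sum>k\<le>m. Bernstein_poly m k)"
      by (simp only: poly_eq_poly_eq_iff)
    have nn: "0 \<le> rin (poly_op J (Bernstein_poly m k) x) x" for k
      using poly_op_Bernstein_nonneg[of k "m - k" x]
      by (simp add: Bernstein_poly_def poly_op_smult rin.scaleR_left)
    have "- (e * rin x x) = - (e * rin (poly_op J (\<Sum>k\<le>m. Bernstein_poly m k) x) x)"
      by (simp add: one[symmetric] poly_op_one)
    also have "\<dots> = (\<Sum>k\<le>m. - e * rin (poly_op J (Bernstein_poly m k) x) x)"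
      by (simp add: poly_op_sum rin.sum_left sum_distrib_left sum_negf)
    also have "\<dots> \<le> (\<Sum>k\<le>m. b k * rin (poly_op J (Bernstein_poly m k) x) x)"
      using m(2) by (intro sum_mono mult_right_mono nn) (auto simp: b_def)
    also have "\<dots> = rin (poly_op J p x) x"
    proof -
      have "poly_op J p x = (\<Sum>k\<le>m. b k *\<^sub>R poly_op J (Bernstein_poly m k) x)"
        using arg_cong[OF p, of "\<lambda>p. poly_op J p x"] by (simp add: poly_op_sum poly_op_smult)
      then show ?thesis by (simp add: rin.sum_left rin.scaleR_left)
    qed
    finally show ?thesis .
  qed
  then have *: "- rin (poly_op J p x) x \<le> e * rin x x" if "0 < e" for e
    using that by fastforce
  have "- rin (poly_op J p x) x \<le> 0"
  proof (rule field_le_epsilon)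
    fix d :: real assume d: "0 < d"
    have n: "0 \<le> rin x x" by (simp add: rin_self)
    have "d / (rin x x + 1) * rin x x \<le> d" using d n by (simp add: field_simps)
    then show "- rin (poly_op J p x) x \<le> 0 + d"
      using *[of "d / (rin x x + 1)"] d n by simp
  qed
  then show ?thesis by simp
qed

text \<open>Positivity applied to c^2 - p^2, together with self-adjointness of p(J).\<close>

lemma norm_poly_op_le:
  assumes "\<And>t. 0 \<le> t \<Longrightarrow> t \<le> 1 \<Longrightarrow> \<bar>poly p t\<bar> \<le> c"
  shows "norm (poly_op J p x) \<le> c * norm x"
proof -
  have c: "0 \<le> c" using assms[of 0] by simp
  have "0 \<le> rin (poly_op J (smult (c\<^sup>2) 1 - p * p) x) x"
  proof (rule poly_op_nonneg)
    fix t :: real assume "0 \<le> t" "t \<le> 1"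
    then have "\<bar>poly p t\<bar>\<^sup>2 \<le> c\<^sup>2" using assms by (intro power_mono) auto
    then show "0 \<le> poly (smult (c\<^sup>2) 1 - p * p) t" by (simp add: power2_eq_square)
  qed
  also have "\<dots> = c\<^sup>2 * rin x x - rin (poly_op J p x) (poly_op J p x)"
    by (simp only: poly_op_diff poly_op_smult poly_op_one poly_op_mult rin.diff_left rin_scaleR_left
        poly_op_selfadjoint[of p "poly_op J p x"])
  finally have "(norm (poly_op J p x))\<^sup>2 \<le> (c * norm x)\<^sup>2"
    by (simp add: rin_self power_mult_distrib)
  then show ?thesis by (rule power2_le_imp_le) (simp add: c)
qed

text \<open>Formally y = (p/w)(J) x with |p/w| <= e. Choose u with |1 - uw| <= 1/2. Then |y| <=
  |y|/2 + |(uw)(J) y|, and (uw)(J) y = (up)(J) x has norm at most (3/2) e |x|. The constant 3 is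
  independent of w, so w may be replaced by arbitrarily high powers.\<close>

lemma poly_op_pos_bounded_below:
  assumes "\<And>t. 0 \<le> t \<Longrightarrow> t \<le> 1 \<Longrightarrow> 0 < poly w t"
    and "\<And>t. 0 \<le> t \<Longrightarrow> t \<le> 1 \<Longrightarrow> \<bar>poly p t\<bar> \<le> e * poly w t"
    and eq: "poly_op J w y = poly_op J p x"
  shows "norm y \<le> 3 * e * norm x"
proof -
  obtain u where u: "\<And>t. 0 \<le> t \<Longrightarrow> t \<le> 1 \<Longrightarrow> \<bar>1 - poly u t * poly w t\<bar> \<le> 1 / 2"
    using poly_approximate_inverse[OF assms(1)] by blast
  have e: "0 \<le> e" using assms(1)[of 0] assms(2)[of 0] by (metis abs_ge_zero order_refl order_trans zero_le_mult_iff not_less zero_le_one)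
  have "norm (poly_op J (1 - u * w) y) \<le> 1 / 2 * norm y"
  proof (rule norm_poly_op_le)
    fix t :: real assume "0 \<le> t" "t \<le> 1"
    then show "\<bar>poly (1 - u * w) t\<bar> \<le> 1 / 2" using u by (simp only: poly_diff poly_1 poly_mult)
  qed
  then have 1: "norm (y - poly_op J (u * w) y) \<le> 1 / 2 * norm y"
    by (simp add: poly_op_diff poly_op_one)
  have "norm (poly_op J (u * p) x) \<le> (3 / 2 * e) * norm x"
  proof (rule norm_poly_op_le)
    fix t :: real assume t: "0 \<le> t" "t \<le> 1"
    have "\<bar>poly (u * p) t\<bar> \<le> \<bar>poly u t\<bar> * (e * poly w t)"
      using assms(2)[OF t] by (simp add: abs_mult mult_left_mono)
    also have "\<dots> = e * \<bar>poly u t * poly w t\<bar>" using assms(1)[OF t] by (simp add: abs_mult)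
    also have "\<dots> \<le> e * (3 / 2)" using u[OF t] e by (intro mult_left_mono) linarith+
    finally show "\<bar>poly (u * p) t\<bar> \<le> 3 / 2 * e" by simp
  qed
  then have 2: "norm (poly_op J (u * w) y) \<le> (3 / 2 * e) * norm x"
    by (simp add: poly_op_mult eq)
  show ?thesis using 1 2 norm_triangle_sub[of y "poly_op J (u * w) y"] by simp
qed

lemma bounded_linear_poly_op: "bounded_linear (poly_op J p)"
proof -
  have "bounded (poly p ` {0..1})"
    by (intro compact_imp_bounded compact_continuous_image continuous_intros) auto
  then obtain c where "\<And>t. 0 \<le> t \<Longrightarrow> t \<le> 1 \<Longrightarrow> \<bar>poly p t\<bar> \<le> c"
    unfolding bounded_iff by (metis atLeastAtMost_iff image_eqI real_norm_def)
  from norm_poly_op_le[OF this] show ?thesis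
    by (intro bounded_linear_intro[of _ c]) (simp_all add: poly_op_add_arg poly_op_scaleR_arg mult.commute)
qed

lemma bounded_linear: "bounded_linear J"
  using bounded_linear_poly_op[of "[:0, 1:]"] by (simp add: poly_op_X[abs_def])

lemma poly_op_pos_inj:
  assumes "\<And>t. 0 \<le> t \<Longrightarrow> t \<le> 1 \<Longrightarrow> 0 < poly w t" "poly_op J w x = poly_op J w y"
  shows "x = y"
proof -
  have "poly_op J w (x - y) = poly_op J 0 0" using assms(2) by (simp add: poly_op_diff_arg poly_op_zero)
  from poly_op_pos_bounded_below[OF assms(1) _ this, of 0] show ?thesis by simp
qed

end

sublocale closed_dense_op \<subseteq> J: positive_contraction "gram_resolvent T"
  by unfold_locales
     (rule gram_resolvent_add gram_resolvent_scaleR gram_resolvent_selfadjoint gram_resolvent_nonneg gram_resolvent_le)+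

subsection \<open>Powers, normal and quasinormal operators\<close>

lemma map_comp_assoc: "(f \<circ>\<^sub>m g) \<circ>\<^sub>m h = f \<circ>\<^sub>m (g \<circ>\<^sub>m h)"
  by (auto simp: map_comp_def fun_eq_iff split: option.splits)

lemma map_comp_Some_right: "f \<circ>\<^sub>m Some = f" and map_comp_Some_left: "Some \<circ>\<^sub>m f = f"
  by (auto simp: map_comp_def fun_eq_iff split: option.splits)

lemma op_pow_add: "op_pow T (m + n) = op_pow T m \<circ>\<^sub>m op_pow T n"
proof (induction n)
  case 0
  show ?case by (simp add: map_comp_Some_right map_comp_Some_left)
next
  case (Suc n)
  then show ?case by (simp add: map_comp_assoc)
qed

lemma op_pow_Suc': "op_pow T (Suc n) = T \<circ>\<^sub>m op_pow T n"
proof -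
  have "op_pow T 1 = T" by (simp add: map_comp_Some_left)
  then show ?thesis using op_pow_add[of T 1 n] by simp
qed

lemma op_pow_commute:
  assumes "S \<circ>\<^sub>m T = T \<circ>\<^sub>m S"
  shows "S \<circ>\<^sub>m op_pow T k = op_pow T k \<circ>\<^sub>m S"
proof (induction k)
  case 0
  show ?case by (simp add: map_comp_Some_right map_comp_Some_left)
next
  case (Suc k)
  have "S \<circ>\<^sub>m op_pow T (Suc k) = (S \<circ>\<^sub>m op_pow T k) \<circ>\<^sub>m T" by (simp add: map_comp_assoc)
  also have "\<dots> = op_pow T k \<circ>\<^sub>m (S \<circ>\<^sub>m T)" by (simp add: Suc.IH map_comp_assoc)
  also have "\<dots> = op_pow T (Suc k) \<circ>\<^sub>m S" by (simp add: assms map_comp_assoc)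
  finally show ?case .
qed

context closed_dense_op
begin

lemma adjoint_diff:
  assumes "adjoint_op T y = Some z" "adjoint_op T y' = Some z'"
  shows "adjoint_op T (y - y') = Some (z - z')"
  using assms unfolding adj_iff by (simp add: rin.diff_right)

lemma adjoint_limit:
  assumes "\<And>k. adjoint_op T (y k) = Some (z k)" "y \<longlonglongrightarrow> y'" "z \<longlonglongrightarrow> z'"
  shows "adjoint_op T y' = Some z'"
  unfolding adj_iff
proof (intro allI impI)
  fix x u assume u: "T x = Some u"
  have "(\<lambda>k. rin u (y k)) \<longlonglongrightarrow> rin u y'" by (intro rin.tendsto tendsto_const assms)
  moreover have "(\<lambda>k. rin u (y k)) = (\<lambda>k. rin x (z k))" using adj_rin[OF assms(1) u] by simp
  moreover have "(\<lambda>k. rin x (z k)) \<longlonglongrightarrow> rin x z'" by (intro rin.tendsto tendsto_const assms)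
  ultimately show "rin u y' = rin x z'" using LIMSEQ_unique by metis
qed

lemma resolvent_gram: "gram T x = Some r \<Longrightarrow> gram_resolvent T r = x - gram_resolvent T x"
  using gram_resolvent_eqI[of x r] by (simp add: gram_resolvent_add algebra_simps)

text \<open>On the domain of T*T the resolvent J satisfies J T*T x = (1 - J) x. Iterating this turns
  powers of an unbounded operator into polynomials of J.\<close>

lemma resolvent_pow_gram:
  "op_pow (gram T) n x = Some z \<Longrightarrow>
    poly_op (gram_resolvent T) ([:0, 1:] ^ n) z = poly_op (gram_resolvent T) ([:1, -1:] ^ n) x"
proof (induction n arbitrary: x)
  case 0
  then show ?case by simp
next
  case (Suc n)
  let ?J = "gram_resolvent T"
  obtain r where r: "gram T x = Some r" "op_pow (gram T) n r = Some z"
    using Suc.prems by (auto simp: map_comp_Some_iff)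
  have "poly_op ?J ([:0, 1:] ^ Suc n) z = poly_op ?J [:0, 1:] (poly_op ?J ([:1, -1:] ^ n) r)"
    using Suc.IH[OF r(2)] by (simp only: power_Suc J.poly_op_mult)
  also have "\<dots> = poly_op ?J ([:1, -1:] ^ n) (?J r)"
    by (subst J.poly_op_commute) (simp only: J.poly_op_X)
  also have "\<dots> = poly_op ?J ([:1, -1:] ^ n) (poly_op ?J [:1, -1:] x)"
    by (simp only: resolvent_gram[OF r(1)] J.poly_op_1_minus_X)
  also have "\<dots> = poly_op ?J ([:1, -1:] ^ Suc n) x"
    by (simp only: power_Suc2 J.poly_op_mult)
  finally show ?case .
qed

end

section \<open>Normal operators: the adjoint and powers of N*N\<close>

locale normal_operator = closed_dense_op N for N :: "'a::complex_hilbert \<rightharpoonup> 'a" +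
  assumes normal: "adjoint_op N \<circ>\<^sub>m N = N \<circ>\<^sub>m adjoint_op N"
begin

lemma gram_commute: "gram N \<circ>\<^sub>m N = N \<circ>\<^sub>m gram N"
proof -
  have "gram N \<circ>\<^sub>m N = (N \<circ>\<^sub>m adjoint_op N) \<circ>\<^sub>m N" by (simp add: gram_def normal)
  then show ?thesis by (simp add: gram_def map_comp_assoc)
qed

text \<open>Here N*Ny = NN*y including definedness, so y lies in the domain of N*, and pairing with
  y gives |Ny| = |N*y|.\<close>

lemma adjoint_on_gram_domain:
  assumes "N y = Some u" "gram N y \<noteq> None"
  shows "\<exists>v. adjoint_op N y = Some v \<and> norm v = norm u"
proof -
  obtain r where r: "gram N y = Some r" using assms(2) by blast
  then have u: "adjoint_op N u = Some r" using assms(1) by (auto simp: gram_Some_iff)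
  have "(N \<circ>\<^sub>m adjoint_op N) y = Some r" using r normal by (simp add: gram_def)
  then obtain v where v: "adjoint_op N y = Some v" "N v = Some r" by (auto simp: map_comp_Some_iff)
  have "rin u u = rin y r" using adj_rin[OF u assms(1)] .
  moreover have "rin r y = rin v v" using adj_rin[OF v] .
  ultimately have "(norm v)\<^sup>2 = (norm u)\<^sup>2" by (simp add: rin_self rin_commute[of r])
  then show ?thesis using v(1) by auto
qed

text \<open>Approximate (x, Nx) in the graph from the core given by \<open>gram_core\<close>.
  Equality of norms on differences makes the adjoint images Cauchy, and N* is closed.\<close>

lemma adjoint_defined:
  assumes "N x = Some u"
  shows "\<exists>v. adjoint_op N x = Some v \<and> norm v = norm u"
proof -
  let ?S = "{(y, v). N y = Some v \<and> gram N y \<noteq> None}"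
  obtain f where f: "\<And>k. f k \<in> ?S" "f \<longlonglongrightarrow> (x, u)"
    using gram_core[OF assms] unfolding closure_sequential by blast
  define y where "y k = fst (f k)" for k
  define v where "v k = snd (f k)" for k
  have yv: "N (y k) = Some (v k)" "gram N (y k) \<noteq> None" for k
    using f(1)[of k] by (auto simp: y_def v_def)
  have lim: "y \<longlonglongrightarrow> x" "v \<longlonglongrightarrow> u"
    using tendsto_fst[OF f(2)] tendsto_snd[OF f(2)] by (simp_all add: y_def[abs_def] v_def[abs_def])
  obtain a where a: "\<And>k. adjoint_op N (y k) = Some (a k)" "\<And>k. norm (a k) = norm (v k)"
    using adjoint_on_gram_domain[OF yv] by metis
  have diff: "norm (a i - a j) = norm (v i - v j)" for i j
  proof -
    have "gram N (y i - y j) \<noteq> None" using yv(2)[of i] yv(2)[of j] gram_diff by fastforce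
    then show ?thesis
      using adjoint_on_gram_domain[OF linear_op_diff[OF linear yv(1) yv(1), of i j]]
        adjoint_diff[OF a(1) a(1), of i j] by auto
  qed
  have "Cauchy v" using lim(2) by (rule LIMSEQ_imp_Cauchy)
  then have "Cauchy a" unfolding Cauchy_def dist_norm diff .
  then obtain a' where a': "a \<longlonglongrightarrow> a'" using Cauchy_convergent_iff convergent_def by blast
  have "adjoint_op N x = Some a'" by (rule adjoint_limit[OF a(1) lim(1) a'])
  moreover have "norm a' = norm u"
    using LIMSEQ_unique[OF tendsto_norm[OF a'] tendsto_norm[OF lim(2), folded a(2)]] .
  ultimately show ?thesis by blast
qed

lemma gram_defined:
  assumes "N x = Some u" "N u = Some v"
  shows "\<exists>r. gram N x = Some r \<and> norm r = norm v"
  using adjoint_defined[OF assms(2)] assms(1) by (auto simp: gram_Some_iff)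

text \<open>The outermost two factors N may be replaced by N*N without changing the norm, and N*N
  then commutes past the remaining N^(2n) to act on x first. This keeps track of domains:
  definedness of N^(2n) x yields that of (N*N)^n x.\<close>

lemma pow_gram:
  "op_pow N (2 * n) x = Some y \<Longrightarrow>
   \<exists>z. op_pow (gram N) n x = Some z \<and> norm z = norm y \<and>
     (\<forall>u y' u'. op_pow N n x = Some u \<longrightarrow> op_pow N n y' = Some u' \<longrightarrow> rin u u' = rin z y')"
proof (induction n arbitrary: x y)
  case 0
  then show ?case by simp
next
  case (Suc n)
  have "op_pow N (2 * Suc n) x = (N \<circ>\<^sub>m (N \<circ>\<^sub>m op_pow N (2 * n))) x"
    by (simp only: mult_Suc_right add_2_eq_Suc op_pow_Suc')
  then obtain a b where ab: "op_pow N (2 * n) x = Some a" "N a = Some b" "N b = Some y"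
    using Suc.prems by (auto simp: map_comp_Some_iff)
  obtain v where v: "gram N a = Some v" "norm v = norm y" using gram_defined[OF ab(2,3)] by blast
  have "(gram N \<circ>\<^sub>m op_pow N (2 * n)) x = Some v" using ab(1) v(1) by simp
  then obtain r where r: "gram N x = Some r" "op_pow N (2 * n) r = Some v"
    unfolding op_pow_commute[OF gram_commute] by (auto simp: map_comp_Some_iff)
  obtain z where z: "op_pow (gram N) n r = Some z" "norm z = norm v"
    "\<And>u y' u'. op_pow N n r = Some u \<Longrightarrow> op_pow N n y' = Some u' \<Longrightarrow> rin u u' = rin z y'"
    using Suc.IH[OF r(2)] by blast
  have "rin u u' = rin z y'" if uu: "op_pow N (Suc n) x = Some u" "op_pow N (Suc n) y' = Some u'" for u y' u'
  proof -
    obtain c d where c: "op_pow N n x = Some c" "N c = Some u" and d: "op_pow N n y' = Some d" "N d = Some u'"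
      using uu unfolding op_pow_Suc' by (auto simp: map_comp_Some_iff)
    \<comment> \<open>Writing 2(n + 1) as n + 1 + (n + 1) shows that N is defined at u = N^(n+1) x,
      so N^n x lies in the domain of N*N.\<close>
    have "op_pow N (2 * Suc n) x = (op_pow N n \<circ>\<^sub>m (N \<circ>\<^sub>m op_pow N (Suc n))) x"
      using op_pow_add[of N n "Suc (Suc n)"] by (simp only: op_pow_Suc'[of N "Suc n"] mult_2 add_Suc add_Suc_right)
    then have "N u \<noteq> None" using Suc.prems uu(1) by (auto simp: map_comp_Some_iff)
    then obtain e where e: "gram N c = Some e" using gram_defined[OF c(2)] by blast
    have "(gram N \<circ>\<^sub>m op_pow N n) x = Some e" using c(1) e by simp
    then have re: "op_pow N n r = Some e"
      unfolding op_pow_commute[OF gram_commute] using r(1) by simp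
    have "adjoint_op N u = Some e" using e c(2) by (auto simp: gram_Some_iff)
    from adj_rin[OF this d(2)] have "rin u' u = rin d e" .
    then have "rin u u' = rin e d" by (simp add: rin_commute)
    also have "\<dots> = rin z y'" by (rule z(3)[OF re d(1)])
    finally show ?thesis .
  qed
  then show ?case using r(1) z v(2) by auto
qed

end

text \<open>Because A*A commutes with A, |A^2 h|^2 = <Ah, A*A Ah> = <Ah, A A*A h> = |A*A h|^2. The
  assumption that A is defined at b puts h in the domain of A A*A.\<close>

lemma quasinormal_square:
  assumes A: "quasinormal A" and h: "gram A h = Some b" and b: "A b = Some y"
  shows "\<exists>a c. A h = Some a \<and> A a = Some c \<and> norm c = norm b \<and> (\<forall>k d. A k = Some d \<longrightarrow> rin a d = rin b k)"
proof -
  interpret closed_dense_op A using A by unfold_locales (auto simp: quasinormal_def)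
  obtain a where a: "A h = Some a" "adjoint_op A a = Some b" using h by (auto simp: gram_Some_iff)
  have "A \<circ>\<^sub>m gram A = gram A \<circ>\<^sub>m A" using A by (simp add: quasinormal_def gram_def)
  then have "(gram A \<circ>\<^sub>m A) h = Some y" using h b by (metis map_comp_simps(2))
  then have "gram A a = Some y" using a(1) by simp
  then obtain c where c: "A a = Some c" "adjoint_op A c = Some y" by (auto simp: gram_Some_iff)
  have "rin c c = rin a y" using adj_rin[OF c(2,1)] .
  also have "\<dots> = rin b b" using adj_rin[OF a(2) b] by (simp add: rin_commute)
  finally have "(norm c)\<^sup>2 = (norm b)\<^sup>2" by (simp add: rin_self)
  moreover have "rin a d = rin b k" if "A k = Some d" for k d
    using adj_rin[OF a(2) that] by (simp add: rin_commute)
  ultimately show ?thesis using a(1) c(1) by auto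
qed

subsection \<open>Subnormal roots\<close>

locale subnormal_root = T: closed_dense_op T + N: normal_operator N
  for T :: "'a::complex_hilbert \<rightharpoonup> 'a" and N :: "'b::complex_hilbert \<rightharpoonup> 'b" +
  fixes V :: "'a \<Rightarrow> 'b" and n :: nat
  assumes V: "isometric_embedding V"
    and extends: "T h = Some t \<Longrightarrow> N (V h) = Some (V t)"
    and n_pos: "0 < n"
    and power_quasinormal: "quasinormal (op_pow T n)"
begin

abbreviation "A \<equiv> op_pow T n"
abbreviation "J \<equiv> gram_resolvent N"
abbreviation "Z \<equiv> gram_resolvent A"
abbreviation "X \<equiv> [:0, 1:] :: real poly"
abbreviation "Y \<equiv> [:1, -1:] :: real poly"

text \<open>Since 1 - J = J N*N on the domain of N*N, w(J) is formally J^n (1 + (N*N)^n); thus J^n /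
  w(J) stands for (1 + (N*N)^n)^(-1).\<close>

definition w :: "real poly" where "w = X ^ n + Y ^ n"

sublocale A: closed_dense_op A
  using power_quasinormal by unfold_locales (auto simp: quasinormal_def)

lemma V_add: "V (x + y) = V x + V y" and norm_V: "norm (V x) = norm x"
  using V by (auto simp: isometric_embedding_def)

lemma V_scaleR: "V (r *\<^sub>R x) = r *\<^sub>R V x"
  using V by (simp add: isometric_embedding_def scaleR_scaleC)

lemma V_diff: "V (x - y) = V x - V y"
  using V_add[of x "-1 *\<^sub>R y"] V_scaleR[of "-1" y] by simp

lemma V_zero: "V 0 = 0"
  using V_scaleR[of 0 0] by simp

lemma V_inj: "V x = V y \<longleftrightarrow> x = y"
  using norm_V[of "x - y"] by (auto simp: V_diff)

lemma rin_V: "rin (V x) (V y) = rin x y"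
  using norm_add_square[of x y] norm_add_square[of "V x" "V y"] by (simp flip: V_add add: norm_V)

lemma bounded_linear_V: "bounded_linear V"
  by (intro bounded_linear_intro[of _ 1]) (auto simp: V_add V_scaleR norm_V)

lemma subspace_range_V: "subspace (range V)"
  using bounded_linear_V by (intro linear_subspace_image bounded_linear.linear) auto

lemma closed_range_V: "closed (range V)"
  by (intro complete_imp_closed complete_isometric_image[of 1])
     (auto simp: norm_V bounded_linear_V complete_UNIV)

section \<open>Intertwining the resolvents of A*A and N*N\<close>

lemma pow_extends: "op_pow T k h = Some t \<Longrightarrow> op_pow N k (V h) = Some (V t)"
  by (induction k arbitrary: h) (auto simp: map_comp_Some_iff dest: extends)

lemma dom_A_subset: "A k \<noteq> None \<Longrightarrow> T k \<noteq> None"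
  using n_pos by (cases n) (auto simp: map_comp_Some_iff)

lemma gram_A_subset: "gram A k = Some r \<Longrightarrow> A k \<noteq> None"
  by (auto simp: gram_Some_iff)

text \<open>Let h = Zg and b = A*Ah = g - h. For g in the domain of A so is b, hence A^2 h exists
  and (N*N)^n Vh is defined. It equals Vb, so J^n Vb = (1 - J)^n Vh; adding J^n Vh to both sides
  gives the claim.\<close>

lemma intertwine_on_domain:
  assumes "A g = Some g1"
  shows "poly_op J w (V (Z g)) = poly_op J (X ^ n) (V g)"
proof -
  define h where "h = Z g"
  define b where "b = g - h"
  have gram: "gram A h = Some b" unfolding h_def b_def by (rule A.gram_resolvent)
  then obtain a where a: "A h = Some a" using gram_A_subset by blast
  have b: "A b = Some (g1 - a)" unfolding b_def using linear_op_diff[OF A.linear assms a] .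
  obtain c where c: "A a = Some c" "norm c = norm b" and ab: "\<And>k d. A k = Some d \<Longrightarrow> rin a d = rin b k"
    using quasinormal_square[OF power_quasinormal gram b] a by auto
  have "op_pow T (2 * n) h = Some c" using a c(1) by (simp add: mult_2 op_pow_add)
  from N.pow_gram[OF pow_extends[OF this]] obtain z where
    z: "op_pow (gram N) n (V h) = Some z" "norm z = norm (V c)"
    and zr: "\<And>u y' u'. op_pow N n (V h) = Some u \<Longrightarrow> op_pow N n y' = Some u' \<Longrightarrow> rin u u' = rin z y'"
    by blast
  have "rin z (V b) = rin (V a) (V (g1 - a))"
    using zr[OF pow_extends[OF a] pow_extends[OF b]] by simp
  also have "\<dots> = rin b b" using ab[OF b] by (simp add: rin_V)
  \<comment> \<open>Both z and Vb have norm |b| and their real inner product is |b|^2: the equality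
    case of Cauchy-Schwarz.\<close>
  finally have "(norm (z - V b))\<^sup>2 = 0"
    using z(2) c(2) by (simp add: norm_diff_square rin_self norm_V)
  then have "z = V b" by simp
  then have "poly_op J (X ^ n) (V b) = poly_op J (Y ^ n) (V h)"
    using N.resolvent_pow_gram[OF z(1)] by simp
  moreover have "V g = V h + V b" by (simp add: b_def flip: V_add)
  ultimately show ?thesis
    unfolding w_def h_def[symmetric] by (simp add: N.J.poly_op_add_arg N.J.poly_op_add)
qed

lemma intertwine: "poly_op J w (V (Z g)) = poly_op J (X ^ n) (V g)"
proof -
  let ?D = "{g. poly_op J w (V (Z g)) = poly_op J (X ^ n) (V g)}"
  note cont = bounded_linear.continuous_on[OF N.J.bounded_linear_poly_op]
    bounded_linear.continuous_on[OF bounded_linear_V] bounded_linear.continuous_on[OF A.J.bounded_linear]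
  have "closed ?D" by (intro closed_Collect_eq cont continuous_on_id)
  moreover have "dom A \<subseteq> ?D" using intertwine_on_domain by auto
  ultimately have "closure (dom A) \<subseteq> ?D" by (rule closure_minimal[rotated])
  then show ?thesis using A.dense by (auto simp: densely_defined_def)
qed

lemma intertwine': "poly_op J w (V (g - Z g)) = poly_op J (Y ^ n) (V g)"
  by (simp add: V_diff N.J.poly_op_diff_arg intertwine) (simp add: w_def N.J.poly_op_add)

lemma poly_w: "poly w t = t ^ n + (1 - t) ^ n"
  by (simp add: w_def poly_power)

lemma poly_w_pos: "0 \<le> t \<Longrightarrow> t \<le> 1 \<Longrightarrow> 0 < poly w t"
  unfolding poly_w by (cases "t = 0") (use n_pos in \<open>auto simp: power_0_left intro!: add_pos_nonneg\<close>)

text \<open>The witness is Z^k (1 - Z)^l g. Powers of w stay on the left as denominators, so w(J)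
  never has to be inverted.\<close>

lemma intertwine_monomial:
  "\<exists>g'. poly_op J (w ^ (k + l)) (V g') = poly_op J ((X ^ n) ^ k * (Y ^ n) ^ l) (V g)"
proof (induction k)
  case 0
  show ?case
  proof (induction l)
    case 0
    show ?case by auto
  next
    case (Suc l)
    then obtain g' where g': "poly_op J (w ^ l) (V g') = poly_op J ((Y ^ n) ^ l) (V g)" by auto
    have "poly_op J (w ^ Suc l) (V (g' - Z g')) = poly_op J (w ^ l) (poly_op J (Y ^ n) (V g'))"
      by (simp only: power_Suc2 N.J.poly_op_mult intertwine')
    also have "\<dots> = poly_op J (Y ^ n) (poly_op J ((Y ^ n) ^ l) (V g))"
      by (simp only: N.J.poly_op_commute[of "w ^ l"] g')
    also have "\<dots> = poly_op J ((Y ^ n) ^ Suc l) (V g)"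
      by (simp only: power_Suc N.J.poly_op_mult)
    finally show ?case by (intro exI[of _ "g' - Z g'"]) (simp only: power_0 mult_1_left add_0)
  qed
next
  case (Suc k)
  then obtain g' where g': "poly_op J (w ^ (k + l)) (V g') = poly_op J ((X ^ n) ^ k * (Y ^ n) ^ l) (V g)" by auto
  have "poly_op J (w ^ (Suc k + l)) (V (Z g')) = poly_op J (w ^ (k + l)) (poly_op J (X ^ n) (V g'))"
    by (simp only: add_Suc power_Suc2 N.J.poly_op_mult intertwine)
  also have "\<dots> = poly_op J (X ^ n) (poly_op J ((X ^ n) ^ k * (Y ^ n) ^ l) (V g))"
    by (simp only: N.J.poly_op_commute[of "w ^ (k + l)"] g')
  also have "\<dots> = poly_op J ((X ^ n) ^ Suc k * (Y ^ n) ^ l) (V g)"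
    by (simp only: power_Suc N.J.poly_op_mult)
  finally show ?case by blast
qed

text \<open>All terms are homogeneous of degree m in X^n and Y^n, so they share the single
  denominator w^m.\<close>

lemma intertwine_sum:
  "\<exists>g'. poly_op J (w ^ m) (V g') = poly_op J (\<Sum>k\<le>m. smult (c k) ((X ^ n) ^ k * (Y ^ n) ^ (m - k))) (V g)"
proof -
  obtain G where G: "\<And>k l. poly_op J (w ^ (k + l)) (V (G k l)) = poly_op J ((X ^ n) ^ k * (Y ^ n) ^ l) (V g)"
    using intertwine_monomial[of _ _ g] by metis
  let ?g = "\<Sum>k\<le>m. c k *\<^sub>R G k (m - k)"
  have "poly_op J (w ^ m) (V ?g) = (\<Sum>k\<le>m. c k *\<^sub>R poly_op J (w ^ m) (V (G k (m - k))))"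
    using bounded_linear.linear[OF bounded_linear_V] bounded_linear.linear[OF N.J.bounded_linear_poly_op, of "w ^ m"]
    by (simp add: linear_sum linear_scale)
  also have "\<dots> = (\<Sum>k\<le>m. c k *\<^sub>R poly_op J ((X ^ n) ^ k * (Y ^ n) ^ (m - k)) (V g))"
    using G[of _ "m - _"] by (intro sum.cong refl) (metis atMost_iff le_add_diff_inverse)
  also have "\<dots> = poly_op J (\<Sum>k\<le>m. smult (c k) ((X ^ n) ^ k * (Y ^ n) ^ (m - k))) (V g)"
    by (simp add: N.J.poly_op_sum N.J.poly_op_smult)
  finally show ?thesis by blast
qed

text \<open>With \<open>y = t\<^sup>n / (t\<^sup>n + (1 - t)\<^sup>n)\<close> one has \<open>t = f y\<close> for the continuous function
  \<open>f y = y\<^sup>1\<^sup>/\<^sup>n / (y\<^sup>1\<^sup>/\<^sup>n + (1 - y)\<^sup>1\<^sup>/\<^sup>n)\<close>; a Bernstein approximation of \<open>f\<close>, cleared of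
  denominators, approximates \<open>J\<close> by polynomials in \<open>(1 + (N\<^sup>*N)\<^sup>n)\<^sup>-\<^sup>1\<close>.\<close>

lemma range_V_invariant: "J (V g) \<in> range V"
proof -
  define f where "f y = root n y / (root n y + root n (1 - y))" for y :: real
  have den: "root n y + root n (1 - y) > 0" if "0 \<le> y" "y \<le> 1" for y
    using that n_pos by (cases "y = 0") (auto intro!: add_pos_nonneg)
  have cont: "continuous_on {0..1} f"
    unfolding f_def using den by (intro continuous_intros) force
  have f: "f (t ^ n / poly w t) = t" if t: "0 \<le> t" "t \<le> 1" for t
  proof -
    have 1: "1 - t ^ n / poly w t = (1 - t) ^ n / poly w t"
      using poly_w_pos[OF t] by (simp add: poly_w field_simps)
    have 2: "root n (t ^ n / poly w t) = t / root n (poly w t)"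
      "root n ((1 - t) ^ n / poly w t) = (1 - t) / root n (poly w t)"
      using t n_pos by (simp_all add: real_root_divide real_root_power_cancel)
    have "root n (poly w t) > 0" using poly_w_pos[OF t] n_pos by simp
    then show ?thesis unfolding f_def 1 2 by (simp flip: add_divide_distrib)
  qed
  have approx: "\<exists>g'. norm (V g' - J (V g)) \<le> 3 * e * norm (V g)" if e: "0 < e" for e
  proof -
    obtain m where m: "\<And>x. x \<in> {0..1} \<Longrightarrow> \<bar>f x - (\<Sum>k\<le>m. f (k / m) * Bernstein m k x)\<bar> < e"
      using Bernstein_Weierstrass[OF cont e] by blast
    define Q where "Q = (\<Sum>k\<le>m. smult (f (k / m) * real (m choose k)) ((X ^ n) ^ k * (Y ^ n) ^ (m - k)))"
    obtain g' where g': "poly_op J (w ^ m) (V g') = poly_op J Q (V g)"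
      using intertwine_sum[of m "\<lambda>k. f (k / m) * real (m choose k)" g] unfolding Q_def by blast
    have Q: "poly Q t = poly w t ^ m * (\<Sum>k\<le>m. f (k / m) * Bernstein m k (t ^ n / poly w t))"
      if t: "0 \<le> t" "t \<le> 1" for t
    proof -
      have 1: "1 - t ^ n / poly w t = (1 - t) ^ n / poly w t"
        using poly_w_pos[OF t] by (simp add: poly_w field_simps)
      have 2: "poly w t ^ m * Bernstein m k (t ^ n / poly w t) = real (m choose k) * (t ^ n) ^ k * ((1 - t) ^ n) ^ (m - k)"
        if k: "k \<le> m" for k
      proof -
        have "poly w t ^ m = poly w t ^ k * poly w t ^ (m - k)" using k by (simp flip: power_add)
        then show ?thesis
          unfolding Bernstein_def 1 power_divide using poly_w_pos[OF t] by (simp add: field_simps)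
      qed
      have "poly Q t = (\<Sum>k\<le>m. f (k / m) * (real (m choose k) * (t ^ n) ^ k * ((1 - t) ^ n) ^ (m - k)))"
        by (simp add: Q_def poly_sum poly_power mult.assoc)
      also have "\<dots> = (\<Sum>k\<le>m. f (k / m) * (poly w t ^ m * Bernstein m k (t ^ n / poly w t)))"
        by (intro sum.cong refl) (simp add: 2)
      finally show ?thesis by (simp add: sum_distrib_left mult.left_commute)
    qed
    have "norm (V g' - J (V g)) \<le> 3 * e * norm (V g)"
    \<comment> \<open>On the unit interval Q differs from w^m X by at most e w^m, so the bound 3e
      does not deteriorate as m grows.\<close>
    proof (rule N.J.poly_op_pos_bounded_below[of "w ^ m" "Q - w ^ m * X"])
      fix t :: real assume t: "0 \<le> t" "t \<le> 1"
      show pos: "0 < poly (w ^ m) t" using poly_w_pos[OF t] by (simp add: poly_power)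
      have "t ^ n \<le> poly w t" using t by (simp add: poly_w)
      then have y: "t ^ n / poly w t \<in> {0..1}" using poly_w_pos[OF t] t by simp
      have "poly (Q - w ^ m * X) t = poly w t ^ m * ((\<Sum>k\<le>m. f (k / m) * Bernstein m k (t ^ n / poly w t)) - f (t ^ n / poly w t))"
        by (simp add: Q[OF t] f[OF t] poly_power right_diff_distrib)
      also have "\<bar>\<dots>\<bar> \<le> poly w t ^ m * e"
        unfolding abs_mult using less_imp_le[OF m[OF y]] poly_w_pos[OF t]
        by (subst abs_of_nonneg) (auto simp: abs_minus_commute intro: mult_left_mono)
      finally show "\<bar>poly (Q - w ^ m * X) t\<bar> \<le> e * poly (w ^ m) t" by (simp add: poly_power mult.commute)
    next
      have "poly_op J (w ^ m) (V g' - J (V g)) = poly_op J Q (V g) - poly_op J (w ^ m) (J (V g))"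
        by (simp add: N.J.poly_op_diff_arg g')
      also have "poly_op J (w ^ m) (J (V g)) = poly_op J (w ^ m * X) (V g)"
        by (simp only: N.J.poly_op_mult N.J.poly_op_X)
      finally show "poly_op J (w ^ m) (V g' - J (V g)) = poly_op J (Q - w ^ m * X) (V g)"
        by (simp only: N.J.poly_op_diff)
    qed
    then show ?thesis by blast
  qed
  have "J (V g) \<in> closure (range V)"
  proof (subst closure_approachable, intro allI impI)
    fix d :: real assume d: "0 < d"
    \<comment> \<open>The added 1 covers Vg = 0 and makes the final inequality strict.\<close>
    let ?e = "d / (3 * (norm (V g) + 1))"
    have n: "0 < norm (V g) + 1" by (simp add: add_nonneg_pos)
    have e: "0 < ?e" using d n by simp
    obtain g' where g': "norm (V g' - J (V g)) \<le> 3 * ?e * norm (V g)" using approx[OF e] by blast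
    also have "\<dots> < 3 * ?e * (norm (V g) + 1)" using e by (intro mult_strict_left_mono) auto
    also have "\<dots> = d" using n by (simp add: field_simps)
    finally show "\<exists>y\<in>range V. dist y (J (V g)) < d" by (auto simp: dist_norm)
  qed
  then show ?thesis using closed_range_V by simp
qed

section \<open>The domain of T as the trace of the domain of N\<close>

lemma poly_op_range_V: "poly_op J p (V g) \<in> range V"
  using range_V_invariant by (intro N.J.poly_op_invariant[OF subspace_range_V]) auto

text \<open>By invariance w(J) Vh = Vg for some g. Intertwining gives w(J) V(Zg) = J^n Vg = w(J) J^n
  Vh, and w(J) is injective. Thus J^n Vh = V(Zg), with Zg in the domain of A*A and so of T.\<close>

lemma resolvent_power_in_domain: "\<exists>k. V k = poly_op J (X ^ n) (V h) \<and> T k \<noteq> None"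
proof -
  obtain g where g: "poly_op J w (V h) = V g" using poly_op_range_V by blast
  have "poly_op J w (V (Z g)) = poly_op J w (poly_op J (X ^ n) (V h))"
    by (simp only: intertwine g[symmetric] N.J.poly_op_commute[of w])
  then have "V (Z g) = poly_op J (X ^ n) (V h)" by (rule N.J.poly_op_pos_inj[rotated]) (rule poly_w_pos)
  then show ?thesis using dom_A_subset gram_A_subset A.gram_resolvent by metis
qed

lemma poly_op_X_power_eq_0: "poly_op J (X ^ k) x = 0 \<Longrightarrow> x = 0"
proof (induction k)
  case (Suc k)
  then show ?case by (simp add: N.J.poly_op_mult N.J.poly_op_X N.gram_resolvent_eq_0 del: mult_pCons_left mult_pCons_right)
qed (simp add: N.J.poly_op_one)

lemma closed_embedded_graph: "closed (map_prod V V ` graph_op T)"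
proof -
  have norm: "norm (map_prod V V p) = norm p" for p by (simp add: norm_prod_def norm_V)
  have "bounded_linear (map_prod V V)"
    by (intro bounded_linear_intro[of _ 1]) (auto simp: norm V_add V_scaleR)
  then show ?thesis
    using subspace_graph_op[OF T.linear] T.closed
    by (intro complete_imp_closed complete_isometric_image[of 1]) (auto simp: norm closed_op_def complete_eq_closed)
qed

lemma subspace_embedded_graph: "subspace (map_prod V V ` graph_op T)"
proof (rule linear_subspace_image[OF _ subspace_graph_op[OF T.linear]])
  show "linear (map_prod V V)" by (rule linearI) (auto simp: V_add V_scaleR)
qed

text \<open>Project (Vh, u) onto the embedded graph of T. The residual is (x, Nx) with x in the
  range of V, and \<open>resolvent_power_in_domain\<close> supplies enough test vectors in the
  domain of T to force x = 0.\<close>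

lemma domain_eq:
  assumes "N (V h) = Some u"
  shows "\<exists>t. T h = Some t \<and> u = V t"
proof -
  let ?G = "map_prod V V ` graph_op T"
  obtain q where q: "q \<in> ?G"
    "\<forall>s\<in>?G. rin (fst ((V h, u) - q)) (fst s) + rin (snd ((V h, u) - q)) (snd s) = 0"
    using rin_prod_projection_exists[OF subspace_embedded_graph closed_embedded_graph] by blast
  obtain k t where kt: "q = (V k, V t)" "T k = Some t" using q(1) by (auto simp: graph_op_iff)
  define x where "x = V (h - k)"
  have Nx: "N x = Some (u - V t)"
    unfolding x_def V_diff using linear_op_diff[OF N.linear assms extends[OF kt(2)]] .
  have orth: "rin x (V k') + rin (u - V t) (V t') = 0" if "T k' = Some t'" for k' t'
    using q(2)[rule_format, of "(V k', V t')"] that by (force simp: kt(1) x_def V_diff graph_op_iff)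
  \<comment> \<open>With y = J^(2n-2) x, the vector Jy = J^n (J^(n-1) x) comes from the domain of T.
    Testing orthogonality there gives 0 = <x, (1 + N*N) Jy> = <x, y> = |J^(n-1) x|^2.\<close>
  define y where "y = poly_op J (X ^ (n - 1)) (poly_op J (X ^ (n - 1)) x)"
  obtain h' where h': "poly_op J (X ^ (n - 1)) x = V h'" using poly_op_range_V x_def by blast
  obtain k' t' where k': "V k' = poly_op J (X ^ n) (V h')" "T k' = Some t'"
    using resolvent_power_in_domain[of h'] by auto
  have "poly_op J (X ^ n) (V h') = poly_op J X (poly_op J (X ^ (n - 1)) (V h'))"
    using n_pos by (simp only: N.J.poly_op_mult[symmetric] power_Suc[symmetric] Suc_diff_1)
  then have Jy: "V k' = J y" by (simp only: k'(1) y_def h' N.J.poly_op_X)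
  have "adjoint_op N (V t') = Some (y - J y)"
    using N.gram_resolvent[of y] extends[OF k'(2)] by (auto simp: gram_Some_iff Jy)
  then have "rin (u - V t) (V t') = rin x (y - J y)" using N.adj_rin Nx by blast
  then have "rin x y = 0" using orth[OF k'(2)] by (simp add: Jy rin.diff_right)
  then have "rin (poly_op J (X ^ (n - 1)) x) (poly_op J (X ^ (n - 1)) x) = 0"
    by (simp add: y_def N.J.poly_op_selfadjoint)
  then have "x = 0" using poly_op_X_power_eq_0 by (simp add: rin_self)
  then have "h = k" using V_inj[of "h - k" 0] by (simp add: x_def V_zero)
  then show ?thesis using kt(2) extends[OF kt(2)] assms by auto
qed

section \<open>T*T as the restriction of N*N\<close>

lemma gram_T_resolvent:
  assumes "V g = J (V h)"
  shows "gram T g = Some (h - g)"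
proof -
  obtain u where u: "N (V g) = Some u" "\<And>x v. N x = Some v \<Longrightarrow> rin v u = rin x (V h - V g)"
    using N.gram_resolvent[of "V h"] unfolding N.gram_iff assms[symmetric] by blast
  obtain t where t: "T g = Some t" "u = V t" using domain_eq[OF u(1)] by blast
  have "rin v t = rin x (h - g)" if "T x = Some v" for x v
    using u(2)[OF extends[OF that]] by (simp add: t(2) rin_V flip: V_diff)
  then show ?thesis unfolding T.gram_iff using t(1) by blast
qed

text \<open>On the range of V, J implements the resolvent of T*T, and each resolvent determines its
  operator. Forwards, the vector obtained from J at V(g + r) must be Vg by uniqueness in the
  resolvent equation.\<close>

lemma gram_T_iff: "gram T g = Some r \<longleftrightarrow> gram N (V g) = Some (V r)"
proof
  assume g: "gram T g = Some r"
  obtain g' where g': "V g' = J (V (g + r))" using range_V_invariant by (metis rangeE)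
  have "g' = g"
    using T.gram_resolvent_unique[OF gram_T_resolvent[OF g'], of g] g by simp
  then show "gram N (V g) = Some (V r)"
    using N.gram_resolvent[of "V (g + r)"] by (simp flip: g' V_diff)
next
  assume "gram N (V g) = Some (V r)"
  then have "J (V (g + r)) = V g" using N.gram_resolvent_eqI by (simp add: V_add)
  then show "gram T g = Some r" using gram_T_resolvent[of g "g + r"] by simp
qed

text \<open>Let q be the component of s orthogonal to the range of V. Since J(Vh + s) = Vh and J
  preserves the range, Jq lies in the range; then |Jq|^2 = <q, J(Jq)> = 0, and injectivity of J
  gives q = 0.\<close>

lemma gram_N_range:
  assumes s: "gram N (V h) = Some s"
  shows "s \<in> range V"
proof -
  obtain p where p: "p \<in> range V" "\<And>k. k \<in> range V \<Longrightarrow> rin (s - p) k = 0"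
    using rin_projection_exists[OF subspace_range_V closed_range_V] by blast
  define q where "q = s - p"
  have "J (V h + s) = V h" by (rule N.gram_resolvent_eqI[OF s])
  moreover have "J (V h + s) = J (V h + p) + J q"
    by (simp add: q_def flip: N.gram_resolvent_add)
  moreover have "J (V h + p) \<in> range V"
    using p(1) range_V_invariant by (auto simp flip: V_add)
  ultimately have Jq: "J q \<in> range V"
    using subspace_diff[OF subspace_range_V, of "V h" "J (V h + p)"] by (metis add_diff_cancel_left' rangeI)
  then obtain k where k: "J q = V k" by blast
  have "rin (J q) (J q) = rin q (J (V k))" by (subst N.gram_resolvent_selfadjoint) (simp only: k)
  also have "\<dots> = 0" unfolding q_def by (rule p(2)[OF range_V_invariant])
  finally have "J q = 0" by (simp add: rin_self)
  then show ?thesis using p(1) by (simp add: N.gram_resolvent_eq_0 q_def)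
qed

text \<open>The commutation of N*N with N is pulled back along V. The intermediate vectors stay in
  the range of V by \<open>domain_eq\<close> in one direction and by \<open>gram_N_range\<close> in
  the other.\<close>

lemma quasinormal_T: "quasinormal T"
proof -
  have "(T \<circ>\<^sub>m gram T) h = Some y \<longleftrightarrow> (gram T \<circ>\<^sub>m T) h = Some y" for h y
  proof
    assume "(T \<circ>\<^sub>m gram T) h = Some y"
    then obtain r where r: "gram T h = Some r" "T r = Some y" by (auto simp: map_comp_Some_iff)
    then have "(N \<circ>\<^sub>m gram N) (V h) = Some (V y)" by (simp add: gram_T_iff extends)
    then have "(gram N \<circ>\<^sub>m N) (V h) = Some (V y)" by (simp only: N.gram_commute)
    then obtain u where "N (V h) = Some u" "gram N u = Some (V y)" by (auto simp: map_comp_Some_iff)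
    then show "(gram T \<circ>\<^sub>m T) h = Some y"
      using domain_eq[of h u] by (auto simp: gram_T_iff map_comp_Some_iff)
  next
    assume "(gram T \<circ>\<^sub>m T) h = Some y"
    then obtain t where t: "T h = Some t" "gram T t = Some y" by (auto simp: map_comp_Some_iff)
    then have "(gram N \<circ>\<^sub>m N) (V h) = Some (V y)" by (simp add: gram_T_iff extends)
    then have "(N \<circ>\<^sub>m gram N) (V h) = Some (V y)" by (simp only: N.gram_commute)
    then obtain s where s: "gram N (V h) = Some s" "N s = Some (V y)" by (auto simp: map_comp_Some_iff)
    obtain r where r: "s = V r" using gram_N_range[OF s(1)] by blast
    then show "(T \<circ>\<^sub>m gram T) h = Some y"
      using s domain_eq[of r "V y"] by (auto simp: gram_T_iff[symmetric] map_comp_Some_iff V_inj)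
  qed
  then have "(T \<circ>\<^sub>m gram T) h = (gram T \<circ>\<^sub>m T) h" for h
    by (metis not_Some_eq)
  then show ?thesis
    using T.linear T.closed T.dense by (auto simp: quasinormal_def gram_def)
qed

end

theorem theorem1p7:
  fixes T :: "'a::complex_hilbert \<rightharpoonup> 'a" and n :: nat
  assumes "linear_op T" and "closed_op T" and "densely_defined T"
    and "n > 1"
    and "subnormal TYPE('b::complex_hilbert) T"
    and "quasinormal (op_pow T n)"
  shows "quasinormal T"
proof -
  obtain V :: "'a \<Rightarrow> 'b" and N where VN: "subnormal_via V N T"
    using assms(5) unfolding subnormal_def by blast
  interpret subnormal_root T N V n
  proof
    show "N (V h) = Some (V t)" if "T h = Some t" for h t
      using VN that unfolding subnormal_via_def by (metis domD domI option.sel)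
  qed (use assms VN in \<open>auto simp: subnormal_via_def normal_op_def\<close>)
  show ?thesis by (rule quasinormal_T)
qed

end
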